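(* Given a finite multigraph $G=(P,E)$ without loops, an orientation of the edges of $E$ maximizing the number of satisfied nodes can be computed in linear time $O(|P|+|E|)$, where a node $p$ is satisfied if at least one edge incident to $p$ is directed toward $p$.
   Context: Nodes represent parents and each edge represents a married couple of children of its two endpoint parents (parallel edges allowed). An orientation assigns each edge a direction, i.e., decides to which parent the couple goes. *)

theory Defs
  imports Complex_Main "HOL-Library.Landau_Symbols"
begin

section \<open>Multigraphs and orientations\<close>

text \<open>Edges have an identity of their own, so distinct edges may have the same two end nodes.\<close>

record ('p, 'e) multigraph =
  nodes :: "'p set"
  edges :: "'e set"
  ends :: "'e \<Rightarrow> 'p set"

definition finite_loopless_multigraph :: "('p, 'e) multigraph \<Rightarrow> bool" where
  "finite_loopless_multigraph G \<longleftrightarrow>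
     finite (nodes G) \<and> finite (edges G) \<and>
     (\<forall>e\<in>edges G. ends G e \<subseteq> nodes G \<and> card (ends G e) = 2)"

text \<open>An orientation is given by the node toward which each edge is directed.
  Its values outside \<open>edges G\<close> are irrelevant.\<close>

definition orientation :: "('p, 'e) multigraph \<Rightarrow> ('e \<Rightarrow> 'p) \<Rightarrow> bool" where
  "orientation G h \<longleftrightarrow> (\<forall>e\<in>edges G. h e \<in> ends G e)"

definition satisfied :: "('p, 'e) multigraph \<Rightarrow> ('e \<Rightarrow> 'p) \<Rightarrow> 'p \<Rightarrow> bool" where
  "satisfied G h p \<longleftrightarrow> (\<exists>e\<in>edges G. p \<in> ends G e \<and> h e = p)"

definition num_satisfied :: "('p, 'e) multigraph \<Rightarrow> ('e \<Rightarrow> 'p) \<Rightarrow> nat" where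
  "num_satisfied G h = card {p \<in> nodes G. satisfied G h p}"

definition max_orientation :: "('p, 'e) multigraph \<Rightarrow> ('e \<Rightarrow> 'p) \<Rightarrow> bool" where
  "max_orientation G h \<longleftrightarrow>
     orientation G h \<and> (\<forall>h'. orientation G h' \<longrightarrow> num_satisfied G h' \<le> num_satisfied G h)"


section \<open>Random access machine programs with unit cost\<close>

text \<open>A state consists of registers (a program mentions only finitely many of them) and a
  memory indexed by natural numbers. Control flow is structured, but each
  elementary operation and each evaluation of a test costs one step.
  The only arithmetic is addition and truncated subtraction.\<close>

type_synonym reg = nat

type_synonym state = "(reg \<Rightarrow> nat) \<times> (nat \<Rightarrow> nat)"

datatype com =
    Skip
  | Const reg nat
  | Move reg reg
  | Add reg reg reg
  | Sub reg reg reg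
  | Load reg reg
  | Store reg reg
  | Seq com com
  | IfLess reg reg com com
  | WhileLess reg reg com

text \<open>\<open>exec W c s t s'\<close>: started in \<open>s\<close>, program \<open>c\<close> terminates in \<open>s'\<close> after exactly \<open>t\<close> steps.
  The parameter \<open>W\<close> is the word bound: computing a number \<open>\<ge> W\<close> is an error, on
  which there is no terminating execution. A bound polynomial in the input size means words
  of logarithmic length. In \<open>Load x a\<close> and \<open>Store a y\<close> the register \<open>a\<close>
  holds the memory address.\<close>

inductive exec :: "nat \<Rightarrow> com \<Rightarrow> state \<Rightarrow> nat \<Rightarrow> state \<Rightarrow> bool" for W :: nat where
  Skip: "exec W Skip s 1 s"
| Const: "n < W \<Longrightarrow> exec W (Const x n) (R, M) 1 (R(x := n), M)"
| Move: "exec W (Move x y) (R, M) 1 (R(x := R y), M)"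
| Add: "R y + R z < W \<Longrightarrow> exec W (Add x y z) (R, M) 1 (R(x := R y + R z), M)"
| Sub: "exec W (Sub x y z) (R, M) 1 (R(x := R y - R z), M)"
| Load: "exec W (Load x a) (R, M) 1 (R(x := M (R a)), M)"
| Store: "exec W (Store a y) (R, M) 1 (R, M(R a := R y))"
| Seq: "exec W c1 s1 t1 s2 \<Longrightarrow> exec W c2 s2 t2 s3 \<Longrightarrow> exec W (Seq c1 c2) s1 (t1 + t2) s3"
| IfTrue: "R x < R y \<Longrightarrow> exec W c1 (R, M) t s' \<Longrightarrow>
    exec W (IfLess x y c1 c2) (R, M) (1 + t) s'"
| IfFalse: "\<not> R x < R y \<Longrightarrow> exec W c2 (R, M) t s' \<Longrightarrow>
    exec W (IfLess x y c1 c2) (R, M) (1 + t) s'"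
| WhileFalse: "\<not> R x < R y \<Longrightarrow> exec W (WhileLess x y c) (R, M) 1 (R, M)"
| WhileTrue: "R x < R y \<Longrightarrow> exec W c (R, M) t1 s2 \<Longrightarrow> exec W (WhileLess x y c) s2 t2 s3 \<Longrightarrow>
    exec W (WhileLess x y c) (R, M) (1 + t1 + t2) s3"

lemma exec_deterministic:
  "exec W c s t s' \<Longrightarrow> exec W c s u s'' \<Longrightarrow> t = u \<and> s' = s''"
proof (induction arbitrary: u s'' rule: exec.induct)
  case (Skip s)
  from Skip.prems show ?case by cases auto
next
  case (Const n x R M)
  from Const.prems show ?case by cases auto
next
  case (Move x y R M)
  from Move.prems show ?case by cases auto
next
  case (Add R y z x M)
  from Add.prems show ?case by cases auto
next
  case (Sub x y z R M)
  from Sub.prems show ?case by cases auto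
next
  case (Load x a R M)
  from Load.prems show ?case by cases auto
next
  case (Store a y R M)
  from Store.prems show ?case by cases auto
next
  case (Seq c1 s1 t1 s2 c2 t2 s3)
  from Seq.prems obtain u1 r u2 where
    "exec W c1 s1 u1 r" "exec W c2 r u2 s''" "u = u1 + u2"
    by cases auto
  with Seq.IH(1)[of u1 r] Seq.IH(2)[of u2 s''] show ?case by simp
next
  case (IfTrue R x y c1 M t s' c2)
  from IfTrue.prems show ?case by cases (use IfTrue.hyps in \<open>auto dest!: IfTrue.IH\<close>)
next
  case (IfFalse R x y c2 M t s' c1)
  from IfFalse.prems show ?case by cases (use IfFalse.hyps in \<open>auto dest!: IfFalse.IH\<close>)
next
  case (WhileFalse R x y c M)
  from WhileFalse.prems show ?case by cases (use WhileFalse.hyps in auto)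
next
  case (WhileTrue R x y c M t1 s2 t2 s3)
  from WhileTrue.prems WhileTrue.hyps(1) obtain u1 r u2 where
    "exec W c (R, M) u1 r" "exec W (WhileLess x y c) r u2 s''" "u = 1 + u1 + u2"
    by cases auto
  with WhileTrue.IH(1)[of u1 r] WhileTrue.IH(2)[of u2 s''] show ?case by simp
qed

text \<open>The input occupies the first cells of an otherwise zero memory, the output the cells
  immediately following the input.\<close>

definition init_state :: "nat list \<Rightarrow> state" where
  "init_state xs = ((\<lambda>_. 0), (\<lambda>a. if a < length xs then xs ! a else 0))"

definition outputs_in :: "nat \<Rightarrow> com \<Rightarrow> nat list \<Rightarrow> nat \<Rightarrow> nat list \<Rightarrow> bool" where
  "outputs_in W c xs t ys \<longleftrightarrow>
     (\<exists>R M. exec W c (init_state xs) t (R, M) \<and>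
            (\<forall>i<length ys. M (length xs + i) = ys ! i))"


section \<open>Representation of multigraphs and orientations in memory\<close>

text \<open>The lists \<open>ps\<close> and \<open>es\<close> fix an arbitrary numbering of the nodes and edges. The input
  is an edge list: the number of nodes, the number of edges, and
  for each edge the numbers of its two end nodes, in either order.\<close>

definition encodes_graph ::
  "('p, 'e) multigraph \<Rightarrow> 'p list \<Rightarrow> 'e list \<Rightarrow> nat list \<Rightarrow> bool" where
  "encodes_graph G ps es xs \<longleftrightarrow>
     distinct ps \<and> set ps = nodes G \<and> distinct es \<and> set es = edges G \<and>
     length xs = 2 + 2 * length es \<and> xs ! 0 = length ps \<and> xs ! 1 = length es \<and>
     (\<forall>i<length es. xs ! (2 + 2 * i) < length ps \<and> xs ! (3 + 2 * i) < length ps \<and>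
        ends G (es ! i) = {ps ! (xs ! (2 + 2 * i)), ps ! (xs ! (3 + 2 * i))})"

definition encodes_orientation ::
  "'p list \<Rightarrow> 'e list \<Rightarrow> ('e \<Rightarrow> 'p) \<Rightarrow> nat list \<Rightarrow> bool" where
  "encodes_orientation ps es h ys \<longleftrightarrow>
     length ys = length es \<and>
     (\<forall>i<length es. ys ! i < length ps \<and> h (es ! i) = ps ! (ys ! i))"

end

theory Submission
  imports Defs
begin

text \<open>Breadth-first search yields a spanning forest. Every edge outside the forest is directed to its
  first end node. Then the forest is traversed against the search order: a node that is
  already satisfied gives its parent edge to its parent, any other node takes it. So every
  non-root is satisfied. If a root is not, then no node has given up its parent edge, and
  each edge in its component is the parent edge of the node it is directed to; thus the component
  has fewer edges than nodes, and every orientation leaves some node of it unsatisfied.\<close>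

text \<open>The greedy choice is safe because all children of a node are treated before it: at its
  turn it is already known whether another edge reaches it. An edge handed to the parent satisfies
  the parent, which then hands on its own parent edge, so a single surplus edge anywhere in a
  component travels up to the root. Breadth-first search suits this since its queue is itself the
  order to be reversed, and the programs have no recursion. Node labels that are constant along
  edges take the place of paths and connected components in the optimality argument. Memory is zero
  at the start; ranks, half-edges and directions are stored with an offset of one, so that 0 means
  absent.\<close>

section \<open>A certificate of optimality\<close>

text \<open>In the class of an unsatisfied node, \<open>h\<close> sends the edges injectively to the
  other nodes, so there are fewer edges than nodes and \<open>h'\<close> cannot satisfy the whole
  class. This assigns to each node unsatisfied by \<open>h\<close> one unsatisfied by
  \<open>h'\<close> with the same label, injectively by \<open>single\<close>.\<close>

lemma max_orientationI:
  fixes comp :: "'p \<Rightarrow> 'c"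
  assumes G: "finite_loopless_multigraph G" and h: "orientation G h"
    and comp: "\<And>e u v. e \<in> edges G \<Longrightarrow> u \<in> ends G e \<Longrightarrow> v \<in> ends G e \<Longrightarrow> comp u = comp v"
    and single: "\<And>p q. p \<in> nodes G \<Longrightarrow> q \<in> nodes G \<Longrightarrow> \<not> satisfied G h p \<Longrightarrow> \<not> satisfied G h q \<Longrightarrow>
      comp p = comp q \<Longrightarrow> p = q"
    and inj: "\<And>p. p \<in> nodes G \<Longrightarrow> \<not> satisfied G h p \<Longrightarrow> inj_on h {e \<in> edges G. comp (h e) = comp p}"
  shows "max_orientation G h"
  unfolding max_orientation_def
proof (intro conjI allI impI h)
  fix h' assume h': "orientation G h'"
  have fin: "finite (nodes G)" "finite (edges G)"
    and sub: "\<And>e. e \<in> edges G \<Longrightarrow> ends G e \<subseteq> nodes G"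
    using G by (auto simp: finite_loopless_multigraph_def)
  define un where "un g = {p \<in> nodes G. \<not> satisfied G g p}" for g
  have num: "num_satisfied G g = card (nodes G) - card (un g)" for g
  proof -
    have "{p \<in> nodes G. satisfied G g p} = nodes G - un g" by (auto simp: un_def)
    then show ?thesis
      unfolding num_satisfied_def using fin by (simp add: card_Diff_subset un_def)
  qed
  have "\<exists>q \<in> un h'. comp q = comp p" if p: "p \<in> un h" for p
  proof (rule ccontr)
    assume "\<not> ?thesis"
    then have all: "satisfied G h' q" if "q \<in> nodes G" "comp q = comp p" for q
      using that by (auto simp: un_def)
    define C where "C = {q \<in> nodes G. comp q = comp p}"
    define F where "F = {e \<in> edges G. comp (h e) = comp p}"
    \<comment> \<open>Labels agree at both ends of an edge, so \<open>F\<close>, though defined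
      through \<open>h\<close>, contains every edge that \<open>h'\<close> can direct into
      \<open>C\<close>.\<close>
    have "C \<subseteq> h' ` F"
    proof
      fix q assume q: "q \<in> C"
      then obtain e where e: "e \<in> edges G" "q \<in> ends G e" "h' e = q"
        using all unfolding C_def satisfied_def by auto
      moreover have "comp (h e) = comp q"
        using comp[OF e(1), of "h e" q] h e by (auto simp: orientation_def)
      ultimately show "q \<in> h' ` F" using q by (auto simp: C_def F_def)
    qed
    moreover have "finite F" using fin by (simp add: F_def)
    ultimately have "card C \<le> card F" by (rule surj_card_le[rotated])
    also have "card F = card (h ` F)"
      using inj[of p] p by (simp add: card_image F_def un_def)
    also have "h ` F \<subseteq> C - {p}"
      using h sub p by (fastforce simp: F_def C_def un_def orientation_def satisfied_def)
    then have "card (h ` F) \<le> card (C - {p})"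
      using fin by (intro card_mono) (auto simp: C_def)
    also have "\<dots> < card C"
      using p fin by (intro card_Diff1_less) (auto simp: C_def un_def)
    finally show False by simp
  qed
  then obtain g where g: "\<And>p. p \<in> un h \<Longrightarrow> g p \<in> un h' \<and> comp (g p) = comp p" by metis
  have "inj_on g (un h)"
    by (rule inj_onI) (metis (mono_tags, lifting) g single un_def mem_Collect_eq)
  then have "card (un h) \<le> card (un h')"
    using g fin by (intro card_inj_on_le[of g]) (auto simp: un_def)
  then show "num_satisfied G h' \<le> num_satisfied G h" by (simp add: num)
qed


section \<open>Programs over named registers and arrays\<close>

text \<open>With names instead of register numbers and addresses, a configuration consists of plain
  functions whose updates are told apart by datatype distinctness.\<close>

datatype var = Zero | One | NodeCount | EdgeCount | Pos | Edg | Half | Src | Tgt | Tmp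
  | Front | Back | Start

datatype arr = Head | Next | Other | EdgeOf | Rank | Queue | Comp | ParEdge | Parent | InTree
  | Sat | Dir

text \<open>The only arithmetic is by one, so no value exceeds the largest input value plus the number
  of steps. Linear running time alone therefore keeps a run within the word bound.\<close>

datatype blk = Nop | Inc var | Dec var | Copy var var
  | Get var arr var | Put arr var var | Read var var | Write var var
  | Then blk blk (infixr \<open>;;\<close> 60) | Cond var var blk blk

text \<open>In a configuration \<open>(R, A, L)\<close>, the memory below the address \<open>b\<close>
  is \<open>L\<close>, the memory from \<open>b\<close> on holds the arrays \<open>A\<close>, interleaved.\<close>

type_synonym conf = "(var \<Rightarrow> nat) \<times> (arr \<Rightarrow> nat \<Rightarrow> nat) \<times> (nat \<Rightarrow> nat)"

text \<open>Blocks have no loops, hence a total effect. Accesses to the lower memory are guarded by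
  \<open>b\<close>: an unguarded write could hit the arrays above it.\<close>

fun eff :: "nat \<Rightarrow> blk \<Rightarrow> conf \<Rightarrow> conf" where
  "eff b Nop s = s"
| "eff b (Inc x) (R, A, L) = (R(x := Suc (R x)), A, L)"
| "eff b (Dec x) (R, A, L) = (R(x := R x - 1), A, L)"
| "eff b (Copy x y) (R, A, L) = (R(x := R y), A, L)"
| "eff b (Get x a i) (R, A, L) = (R(x := A a (R i)), A, L)"
| "eff b (Put a i y) (R, A, L) = (R, A(a := (A a)(R i := R y)), L)"
| "eff b (Read x i) (R, A, L) = (if R i < b then (R(x := L (R i)), A, L) else (R, A, L))"
| "eff b (Write i y) (R, A, L) = (if R i < b then (R, A, L(R i := R y)) else (R, A, L))"
| "eff b (c1 ;; c2) s = eff b c2 (eff b c1 s)"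
| "eff b (Cond x y c1 c2) (R, A, L) = eff b (if R x < R y then c1 else c2) (R, A, L)"

text \<open>A static bound, so both branches of \<open>Cond\<close> count. A unit stands for at most
  ten machine steps, of which an address computation takes eight.\<close>

primrec len :: "blk \<Rightarrow> nat" where
  "len Nop = 1"
| "len (Inc x) = 1"
| "len (Dec x) = 1"
| "len (Copy x y) = 1"
| "len (Get x a i) = 1"
| "len (Put a i y) = 1"
| "len (Read x i) = 1"
| "len (Write i y) = 1"
| "len (c1 ;; c2) = len c1 + len c2"
| "len (Cond x y c1 c2) = 1 + len c1 + len c2"

text \<open>Register 0 holds \<open>b\<close>; registers 1 and 2 are scratch.\<close>

primrec reg_of :: "var \<Rightarrow> reg" where
  "reg_of Zero = 3" | "reg_of One = 4" | "reg_of NodeCount = 5" | "reg_of EdgeCount = 6"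
| "reg_of Pos = 7" | "reg_of Edg = 8" | "reg_of Half = 9" | "reg_of Src = 10"
| "reg_of Tgt = 11" | "reg_of Tmp = 12" | "reg_of Front = 13" | "reg_of Back = 14"
| "reg_of Start = 15"

primrec slot :: "arr \<Rightarrow> nat" where
  "slot Head = 0" | "slot Next = 1" | "slot Other = 2" | "slot EdgeOf = 3" | "slot Rank = 4"
| "slot Queue = 5" | "slot Comp = 6" | "slot ParEdge = 7" | "slot Parent = 8"
| "slot InTree = 9" | "slot Sat = 10" | "slot Dir = 11"

lemma reg_of_gt_2: "2 < reg_of x"
  by (cases x) simp_all

lemma reg_of_eq_iff [simp]: "reg_of x = reg_of y \<longleftrightarrow> x = y"
  by (cases x; cases y) simp_all

lemma reg_of_neq [simp]:
  "reg_of x \<noteq> 0" "reg_of x \<noteq> 1" "reg_of x \<noteq> Suc 0" "reg_of x \<noteq> 2"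
  "0 \<noteq> reg_of x" "1 \<noteq> reg_of x" "Suc 0 \<noteq> reg_of x" "2 \<noteq> reg_of x"
  using reg_of_gt_2[of x] by auto

lemma slot_less: "slot a < 16"
  by (cases a) simp_all

lemma slot_eq_iff: "slot a = slot a' \<longleftrightarrow> a = a'"
  by (cases a; cases a') simp_all

lemma address_eq_iff [simp]: "16 * i + slot a = 16 * j + slot a' \<longleftrightarrow> i = j \<and> a = a'"
proof
  assume "16 * i + slot a = 16 * j + slot a'"
  with slot_less[of a] slot_less[of a'] have "i = j \<and> slot a = slot a'" by presburger
  then show "i = j \<and> a = a'" by (simp add: slot_eq_iff)
qed simp

text \<open>Four doublings replace a multiplication by 16, a power of two with room for the twelve
  arrays. Interleaving them spares any bound on their sizes.\<close>

definition addr :: "arr \<Rightarrow> var \<Rightarrow> com" where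
  "addr a i = Seq (Const 2 (slot a)) (Seq (Move 1 (reg_of i)) (Seq (Add 1 1 1) (Seq (Add 1 1 1)
     (Seq (Add 1 1 1) (Seq (Add 1 1 1) (Seq (Add 1 1 2) (Add 1 1 0)))))))"

primrec compile :: "blk \<Rightarrow> com" where
  "compile Nop = Skip"
| "compile (Inc x) = Seq (Const 1 1) (Add (reg_of x) (reg_of x) 1)"
| "compile (Dec x) = Seq (Const 1 1) (Sub (reg_of x) (reg_of x) 1)"
| "compile (Copy x y) = Move (reg_of x) (reg_of y)"
| "compile (Get x a i) = Seq (addr a i) (Load (reg_of x) 1)"
| "compile (Put a i y) = Seq (addr a i) (Store 1 (reg_of y))"
| "compile (Read x i) = IfLess (reg_of i) 0 (Load (reg_of x) (reg_of i)) Skip"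
| "compile (Write i y) = IfLess (reg_of i) 0 (Store (reg_of i) (reg_of y)) Skip"
| "compile (c1 ;; c2) = Seq (compile c1) (compile c2)"
| "compile (Cond x y c1 c2) = IfLess (reg_of x) (reg_of y) (compile c1) (compile c2)"

section \<open>Simulation of blocks by machine programs\<close>

fun represents :: "nat \<Rightarrow> conf \<Rightarrow> state \<Rightarrow> bool" where
  "represents b (R, A, L) (R', M) \<longleftrightarrow>
     R' 0 = b \<and> (\<forall>x. R' (reg_of x) = R x) \<and>
     (\<forall>a i. M (b + (16 * i + slot a)) = A a i) \<and> (\<forall>i<b. M i = L i)"

fun bounded_by :: "nat \<Rightarrow> conf \<Rightarrow> bool" where
  "bounded_by B (R, A, L) \<longleftrightarrow> (\<forall>x. R x \<le> B) \<and> (\<forall>a i. A a i \<le> B) \<and> (\<forall>i. L i \<le> B)"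

lemma bounded_by_mono: "bounded_by B s \<Longrightarrow> B \<le> B' \<Longrightarrow> bounded_by B' s"
  by (cases s) (auto intro: order_trans)

text \<open>The number \<open>j\<close> bounds both the steps (up to a constant factor) and the growth of values.\<close>

definition runs :: "nat \<Rightarrow> com \<Rightarrow> nat \<Rightarrow> conf \<Rightarrow> conf \<Rightarrow> bool" where
  "runs b c j s s' \<longleftrightarrow> (\<forall>W B S. represents b s S \<longrightarrow> bounded_by B s \<longrightarrow> b + 16 * (B + j) + 16 < W \<longrightarrow>
     (\<exists>t S'. exec W c S t S' \<and> t \<le> 10 * j \<and> represents b s' S' \<and> bounded_by (B + j) s'))"

lemma exec_addr:
  assumes "R 0 + 16 * R (reg_of i) + 16 < W"
  shows "exec W (addr a i) (R, M) 8 (R(2 := slot a, 1 := R 0 + (16 * R (reg_of i) + slot a)), M)"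
proof -
  define R' where "R' = R(2 := slot a)"
  define r where "r = R (reg_of i)"
  have r: "R' (reg_of i) = r" "R 0 + 16 * r + 16 < W" "slot a < 16" "R' 2 = slot a" "R' 0 = R 0"
    using assms slot_less by (auto simp: R'_def r_def)
  have add: "exec W (Add 1 1 z) (R'(1 := v), M) 1 (R'(1 := w), M)"
    if "w < W" "w = v + (R'(1 := v)) z" for v w z
    using exec.Add[of "R'(1 := v)" 1 z W 1 M] that by simp
  \<comment> \<open>The number is spelled out as a nested sum because \<open>exec.Seq\<close> has to
    unify with it.\<close>
  have eight: "(8 :: nat) = 1 + (1 + (1 + (1 + (1 + (1 + (1 + 1))))))" by simp
  have "exec W (addr a i) (R, M) (1 + (1 + (1 + (1 + (1 + (1 + (1 + 1)))))))
      (R'(1 := R 0 + (16 * r + slot a)), M)"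
    unfolding addr_def
  proof (intro exec.Seq)
    show "exec W (Const 2 (slot a)) (R, M) 1 (R', M)"
      unfolding R'_def using r by (intro exec.Const) simp
    show "exec W (Move 1 (reg_of i)) (R', M) 1 (R'(1 := r), M)"
      using exec.Move[of W 1 "reg_of i" R' M] r by simp
    show "exec W (Add 1 1 1) (R'(1 := r), M) 1 (R'(1 := 2 * r), M)"
      "exec W (Add 1 1 1) (R'(1 := 2 * r), M) 1 (R'(1 := 4 * r), M)"
      "exec W (Add 1 1 1) (R'(1 := 4 * r), M) 1 (R'(1 := 8 * r), M)"
      "exec W (Add 1 1 1) (R'(1 := 8 * r), M) 1 (R'(1 := 16 * r), M)"
      "exec W (Add 1 1 2) (R'(1 := 16 * r), M) 1 (R'(1 := 16 * r + slot a), M)"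
      "exec W (Add 1 1 0) (R'(1 := 16 * r + slot a), M) 1 (R'(1 := R 0 + (16 * r + slot a)), M)"
      using r by (intro add; simp)+
  qed
  then show ?thesis unfolding R'_def r_def eight .
qed

lemma runsE:
  assumes "runs b c j s s'" "represents b s S" "bounded_by B s" "b + 16 * (B + j) + 16 < W"
  obtains t S' where "exec W c S t S'" "t \<le> 10 * j" "represents b s' S'" "bounded_by (B + j) s'"
  using assms unfolding runs_def by blast

lemma runs_mono: "runs b c j s s' \<Longrightarrow> j \<le> j' \<Longrightarrow> runs b c j' s s'"
proof (subst runs_def, intro allI impI)
  fix W B S
  assume *: "runs b c j s s'" and j: "j \<le> j'"
    and S: "represents b s S" "bounded_by B s" and W: "b + 16 * (B + j') + 16 < W"
  obtain t S' where t: "exec W c S t S'" "t \<le> 10 * j" "represents b s' S'" "bounded_by (B + j) s'"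
    using W j by (auto intro: runsE[OF * S, of W])
  moreover have "bounded_by (B + j') s'" "t \<le> 10 * j'"
    using bounded_by_mono[OF t(4)] t(2) j by auto
  ultimately show "\<exists>t S'. exec W c S t S' \<and> t \<le> 10 * j' \<and> represents b s' S' \<and> bounded_by (B + j') s'"
    by blast
qed

text \<open>The value bound is quantified inside \<open>runs\<close>, so the second program may
  start from \<open>B + j1\<close>.\<close>

lemma runs_Seq:
  assumes "runs b c1 j1 s s'" "runs b c2 j2 s' s''"
  shows "runs b (Seq c1 c2) (j1 + j2) s s''"
  unfolding runs_def
proof (intro allI impI)
  fix W B S
  assume S: "represents b s S" "bounded_by B s" and W: "b + 16 * (B + (j1 + j2)) + 16 < W"
  obtain t S' where 1: "exec W c1 S t S'" "t \<le> 10 * j1" "represents b s' S'" "bounded_by (B + j1) s'"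
    using W by (auto intro: runsE[OF assms(1) S, of W])
  obtain t' S'' where 2: "exec W c2 S' t' S''" "t' \<le> 10 * j2" "represents b s'' S''"
      "bounded_by (B + j1 + j2) s''"
    using W by (auto simp: add.assoc intro: runsE[OF assms(2) 1(3,4), of W])
  show "\<exists>t S'. exec W (Seq c1 c2) S t S' \<and> t \<le> 10 * (j1 + j2) \<and> represents b s'' S' \<and>
      bounded_by (B + (j1 + j2)) s''"
    using exec.Seq[OF 1(1) 2(1)] 1(2) 2(2-4)
    by (intro exI[of _ "t + t'"] exI[of _ S''] conjI) (simp_all add: add.assoc)
qed

text \<open>The single unit contributes another 16 to the word bound, hence the 32: room for an
  address with its slot, and for an increment.\<close>

lemma runs_atomI:
  assumes "\<And>W R' M. represents b (R, A, L) (R', M) \<Longrightarrow> (\<And>x. b + 16 * R x + 32 < W) \<Longrightarrow>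
      exec W c (R', M) t (f R' M)"
    and "\<And>R' M. represents b (R, A, L) (R', M) \<Longrightarrow> represents b s' (f R' M)"
    and "\<And>B. bounded_by B (R, A, L) \<Longrightarrow> bounded_by (B + 1) s'"
    and "t \<le> 10"
  shows "runs b c 1 (R, A, L) s'"
  unfolding runs_def
proof (intro allI impI)
  fix W B S
  assume S: "represents b (R, A, L) S" and B: "bounded_by B (R, A, L)" and W: "b + 16 * (B + 1) + 16 < W"
  obtain R' M where eq: "S = (R', M)" by (cases S)
  have "b + 16 * R x + 32 < W" for x
  proof -
    have "16 * R x \<le> 16 * B" using B by simp
    with W show ?thesis by simp
  qed
  then have "exec W c S t (f R' M)" using assms(1) S eq by blast
  moreover have "represents b s' (f R' M)" using assms(2) S eq by blast
  ultimately show "\<exists>t S'. exec W c S t S' \<and> t \<le> 10 * 1 \<and> represents b s' S' \<and> bounded_by (B + 1) s'"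
    using assms(3)[OF B] assms(4) by (intro exI[of _ t] exI[of _ "f R' M"]) simp
qed

lemma runs_compile: "runs b (compile c) (len c) s (eff b c s)"
proof (induction c arbitrary: s)
  case Nop
  obtain R A L where s: "s = (R, A, L)" by (cases s)
  show ?case
    unfolding s compile.simps len.simps
    by (rule runs_atomI[where f = Pair, OF exec.Skip]) (auto simp: le_SucI)
next
  case (Inc x)
  obtain R A L where s: "s = (R, A, L)" by (cases s)
  let ?f = "\<lambda>R' M. (R'(1 := 1, reg_of x := R x + 1), M)"
  show ?case
    unfolding s compile.simps len.simps
  proof (rule runs_atomI[where f = ?f])
    fix W R' M assume r: "represents b (R, A, L) (R', M)" and W: "\<And>x. b + 16 * R x + 32 < W"
    show "exec W (Seq (Const 1 1) (Add (reg_of x) (reg_of x) 1)) (R', M) (1 + 1) (?f R' M)"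
      using exec.Seq[OF exec.Const[of 1 W 1 R' M] exec.Add[of "R'(1 := 1)" "reg_of x" 1 W "reg_of x" M]]
        r W[of x] by simp
  qed (auto simp: le_SucI)
next
  case (Dec x)
  obtain R A L where s: "s = (R, A, L)" by (cases s)
  let ?f = "\<lambda>R' M. (R'(1 := 1, reg_of x := R x - 1), M)"
  show ?case
    unfolding s compile.simps len.simps
  proof (rule runs_atomI[where f = ?f])
    fix W R' M assume r: "represents b (R, A, L) (R', M)" and W: "\<And>x. b + 16 * R x + 32 < W"
    show "exec W (Seq (Const 1 1) (Sub (reg_of x) (reg_of x) 1)) (R', M) (1 + 1) (?f R' M)"
      using exec.Seq[OF exec.Const[of 1 W 1 R' M] exec.Sub[of W "reg_of x" "reg_of x" 1 "R'(1 := 1)" M]]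
        r W[of x] by simp
  qed (auto simp: le_SucI intro: le_trans[OF diff_le_self])
next
  case (Copy x y)
  obtain R A L where s: "s = (R, A, L)" by (cases s)
  show ?case
    unfolding s compile.simps len.simps
    by (rule runs_atomI[where f = "\<lambda>R' M. (R'(reg_of x := R' (reg_of y)), M)", OF exec.Move])
      (auto simp: le_SucI)
next
  case (Get x a i)
  obtain R A L where s: "s = (R, A, L)" by (cases s)
  let ?f = "\<lambda>R' M. (R'(2 := slot a, 1 := b + (16 * R i + slot a), reg_of x := A a (R i)), M)"
  show ?case
    unfolding s compile.simps len.simps
  proof (rule runs_atomI[where f = ?f])
    fix W R' M assume r: "represents b (R, A, L) (R', M)" and W: "\<And>x. b + 16 * R x + 32 < W"
    have "R' 0 + 16 * R' (reg_of i) + 16 < W" using r W[of i] by simp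
    from exec.Seq[OF exec_addr[OF this, of a M] exec.Load[of W "reg_of x" 1]]
    show "exec W (Seq (addr a i) (Load (reg_of x) 1)) (R', M) (8 + 1) (?f R' M)" using r by simp
  qed (auto simp: le_SucI)
next
  case (Put a i y)
  obtain R A L where s: "s = (R, A, L)" by (cases s)
  let ?f = "\<lambda>R' M. (R'(2 := slot a, 1 := b + (16 * R i + slot a)), M(b + (16 * R i + slot a) := R y))"
  show ?case
    unfolding s compile.simps len.simps
  proof (rule runs_atomI[where f = ?f])
    fix W R' M assume r: "represents b (R, A, L) (R', M)" and W: "\<And>x. b + 16 * R x + 32 < W"
    have "R' 0 + 16 * R' (reg_of i) + 16 < W" using r W[of i] by simp
    from exec.Seq[OF exec_addr[OF this, of a M] exec.Store[of W 1 "reg_of y"]]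
    show "exec W (Seq (addr a i) (Store 1 (reg_of y))) (R', M) (8 + 1) (?f R' M)" using r by simp
  qed (auto simp: le_SucI)
next
  case (Read x i)
  obtain R A L where s: "s = (R, A, L)" by (cases s)
  let ?f = "\<lambda>R' M. if R i < b then (R'(reg_of x := M (R i)), M) else (R', M)"
  show ?case
    unfolding s compile.simps len.simps
  proof (rule runs_atomI[where f = ?f])
    fix W R' M assume r: "represents b (R, A, L) (R', M)"
    show "exec W (IfLess (reg_of i) 0 (Load (reg_of x) (reg_of i)) Skip) (R', M) (1 + 1) (?f R' M)"
      using exec.IfTrue[of R' "reg_of i" 0, OF _ exec.Load[of W "reg_of x" "reg_of i" R' M]]
        exec.IfFalse[of R' "reg_of i" 0, OF _ exec.Skip] r by auto
  qed (auto simp: le_SucI)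
next
  case (Write i y)
  obtain R A L where s: "s = (R, A, L)" by (cases s)
  let ?f = "\<lambda>R' M. if R i < b then (R', M(R i := R y)) else (R', M)"
  show ?case
    unfolding s compile.simps len.simps
  proof (rule runs_atomI[where f = ?f])
    fix W R' M assume r: "represents b (R, A, L) (R', M)"
    show "exec W (IfLess (reg_of i) 0 (Store (reg_of i) (reg_of y)) Skip) (R', M) (1 + 1) (?f R' M)"
      using exec.IfTrue[of R' "reg_of i" 0, OF _ exec.Store[of W "reg_of i" "reg_of y" R' M]]
        exec.IfFalse[of R' "reg_of i" 0, OF _ exec.Skip] r by auto
  qed (auto simp: le_SucI)
next
  case (Then c1 c2)
  show ?case unfolding compile.simps len.simps eff.simps by (rule runs_Seq[OF Then.IH])
next
  case (Cond x y c1 c2)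
  show ?case
    unfolding runs_def
  proof (intro allI impI)
    fix W B S
    assume H: "represents b s S" "bounded_by B s" "b + 16 * (B + len (Cond x y c1 c2)) + 16 < W"
    obtain R A L R' M where s: "s = (R, A, L)" "S = (R', M)" by (cases s, cases S) auto
    let ?c = "if R x < R y then c1 else c2"
    have "runs b (compile ?c) (len c1 + len c2) s (eff b ?c s)"
      using runs_mono[OF Cond.IH(1)] runs_mono[OF Cond.IH(2)] by simp
    then obtain t S' where t: "exec W (compile ?c) S t S'" "t \<le> 10 * (len c1 + len c2)"
        "represents b (eff b ?c s) S'" "bounded_by (B + (len c1 + len c2)) (eff b ?c s)"
      using H(3) by (auto intro: runsE[OF _ H(1,2), of _ _ _ W])
    have "exec W (compile (Cond x y c1 c2)) S (1 + t) S'"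
      using t(1) H s exec.IfTrue[of R' "reg_of x" "reg_of y"] exec.IfFalse[of R' "reg_of x" "reg_of y"]
      by (auto split: if_splits)
    moreover have "bounded_by (B + len (Cond x y c1 c2)) (eff b ?c s)"
      by (rule bounded_by_mono[OF t(4)]) simp
    ultimately show "\<exists>t S'. exec W (compile (Cond x y c1 c2)) S t S' \<and> t \<le> 10 * len (Cond x y c1 c2) \<and>
        represents b (eff b (Cond x y c1 c2) s) S' \<and>
        bounded_by (B + len (Cond x y c1 c2)) (eff b (Cond x y c1 c2) s)"
      using t(2,3) s by (intro exI[of _ "1 + t"] exI[of _ S']) auto
  qed
qed

section \<open>Loops with amortised cost\<close>

definition loop :: "var \<Rightarrow> var \<Rightarrow> blk \<Rightarrow> com" where
  "loop x y c = WhileLess (reg_of x) (reg_of y) (compile c)"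

text \<open>Since the potential \<open>f\<close> is a function of the configuration, costs may be amortised.\<close>

lemma runs_loop:
  assumes "I s"
    and step: "\<And>s. I s \<Longrightarrow> fst s x < fst s y \<Longrightarrow> I (eff b c s) \<and> f (eff b c s) < (f s :: nat)"
  shows "\<exists>s'. runs b (loop x y c) (Suc (len c) * f s + 1) s s' \<and> I s' \<and> \<not> fst s' x < fst s' y"
  using assms(1)
proof (induction "f s" arbitrary: s rule: less_induct)
  case less
  obtain R A L where s: "s = (R, A, L)" by (cases s)
  show ?case
  proof (cases "R x < R y")
    case False
    then have "runs b (loop x y c) (Suc (len c) * f s + 1) s s"
      unfolding runs_def loop_def s
      by (auto intro!: exI exec.WhileFalse simp del: bounded_by.simps elim: bounded_by_mono)
    with False less.prems s show ?thesis by auto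
  next
    case True
    let ?s = "eff b c s"
    have *: "I ?s" "f ?s < f s" using step[OF less.prems] True s by auto
    obtain s' where s': "runs b (loop x y c) (Suc (len c) * f ?s + 1) ?s s'" "I s'"
        "\<not> fst s' x < fst s' y"
      using less.hyps[OF *(2,1)] by blast
    let ?j = "len c + (Suc (len c) * f ?s + 1)"
    \<comment> \<open>A drop of \<open>f\<close> by at least one pays \<open>Suc (len c)\<close>:
      one unit for the test, the rest for the body.\<close>
    have j: "Suc ?j \<le> Suc (len c) * f s + 1"
      using mult_le_mono2[of "Suc (f ?s)" "f s" "Suc (len c)"] *(2) by simp
    \<comment> \<open>The unrolled loop is treated as a sequence to reuse \<open>runs_Seq\<close>;
      inverting \<open>Seq\<close> below returns the two executions that \<open>WhileTrue\<close>
      asks for.\<close>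
    have seq: "runs b (Seq (compile c) (loop x y c)) ?j s s'"
      by (rule runs_Seq[OF runs_compile s'(1)])
    have "runs b (loop x y c) (Suc ?j) s s'"
      unfolding runs_def
    proof (intro allI impI)
      fix W B S assume H: "represents b s S" "bounded_by B s" "b + 16 * (B + Suc ?j) + 16 < W"
      obtain R' M where S: "S = (R', M)" by (cases S)
      obtain t S' where t: "exec W (Seq (compile c) (loop x y c)) S t S'" "t \<le> 10 * ?j"
          "represents b s' S'" "bounded_by (B + ?j) s'"
        using H(3) by (auto intro: runsE[OF seq H(1,2), of W])
      from t(1) obtain t1 S1 t2 where "exec W (compile c) S t1 S1"
          "exec W (loop x y c) S1 t2 S'" "t = t1 + t2"
        by cases auto
      then have "exec W (loop x y c) S (1 + t1 + t2) S'" "t = t1 + t2"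
        using exec.WhileTrue[of R' "reg_of x" "reg_of y"] True H(1) s S unfolding loop_def by auto
      moreover have "bounded_by (B + Suc ?j) s'"
        by (rule bounded_by_mono[OF t(4)]) simp
      ultimately show "\<exists>t S'. exec W (loop x y c) S t S' \<and> t \<le> 10 * Suc ?j \<and>
          represents b s' S' \<and> bounded_by (B + Suc ?j) s'"
        using t(2,3) by (intro exI[of _ "1 + t1 + t2"] exI[of _ S']) auto
    qed
    then show ?thesis using runs_mono[OF _ j] s' by blast
  qed
qed

lemma runs_loopE:
  assumes "I s" "f s \<le> p"
    and "\<And>R A L. I (R, A, L) \<Longrightarrow> R x < R y \<Longrightarrow> I (eff b c (R, A, L)) \<and> f (eff b c (R, A, L)) < (f (R, A, L) :: nat)"
  obtains s' where "runs b (loop x y c) (Suc (len c) * p + 1) s s'" "I s'" "\<not> fst s' x < fst s' y"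
proof -
  obtain s' where s': "runs b (loop x y c) (Suc (len c) * f s + 1) s s'" "I s'" "\<not> fst s' x < fst s' y"
    using runs_loop[of I s x y b c f] assms by force
  moreover have "Suc (len c) * f s + 1 \<le> Suc (len c) * p + 1"
    using assms(2) by (intro add_le_mono1 mult_le_mono2)
  ultimately show ?thesis using that runs_mono by blast
qed


section \<open>The algorithm\<close>

text \<open>Edge \<open>e\<close> gives rise to the half-edges \<open>2 * e + 1\<close> and \<open>2 * e + 2\<close>, which leave its first and
  its second end node. The half-edges leaving a node form a linked list; 0 is the null pointer.\<close>

definition link :: "var \<Rightarrow> var \<Rightarrow> blk" where
  "link u v = Inc Half ;; Put Other Half v ;; Put EdgeOf Half Edg ;;
     Get Tmp Head u ;; Put Next Half Tmp ;; Put Head u Half"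

definition build_body :: blk where
  "build_body = Read Src Pos ;; Inc Pos ;; Read Tgt Pos ;; Inc Pos ;;
     link Src Tgt ;; link Tgt Src ;; Inc Edg"

text \<open>One loop performs breadth-first search from every node: an iteration processes one half-edge,
  or dequeues a node, or advances the next candidate \<open>Start\<close> for a root. The rank of a node is
  its position in the queue plus one, and 0 as long as the node is unvisited. \<open>Comp v\<close> is the root
  of the tree of \<open>v\<close>.\<close>

definition search_body :: blk where
  "search_body =
     Cond Front Back
       (Get Src Queue Front ;; Get Half Head Src ;;
        Cond Zero Half
          (Get Tmp Next Half ;; Put Head Src Tmp ;; Get Tgt Other Half ;; Get Tmp Rank Tgt ;;
           Cond Zero Tmp Nop
             (Get Edg EdgeOf Half ;; Put ParEdge Tgt Edg ;; Put Parent Tgt Src ;;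
              Put InTree Edg One ;; Get Tmp Comp Src ;; Put Comp Tgt Tmp ;;
              Put Queue Back Tgt ;; Inc Back ;; Put Rank Tgt Back))
          (Inc Front))
       (Get Tmp Rank Start ;;
        Cond Zero Tmp (Inc Start)
          (Put Comp Start Start ;; Put Queue Back Start ;; Inc Back ;; Put Rank Start Back))"

text \<open>\<open>Dir e\<close> is one more than the node toward which \<open>e\<close> is directed, and 0 if \<open>e\<close> is undirected.\<close>

definition extra_body :: blk where
  "extra_body = Get Tmp InTree Edg ;; Read Src Pos ;; Inc Pos ;; Inc Pos ;;
     Cond Zero Tmp Nop (Put Sat Src One ;; Inc Src ;; Put Dir Edg Src) ;; Inc Edg"

text \<open>The parent edge is fetched first because \<open>Src\<close> may then be replaced by the
  parent.\<close>

definition settle :: blk where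
  "settle = Get Edg ParEdge Src ;; Get Tmp Sat Src ;; Cond Zero Tmp (Get Src Parent Src) Nop ;;
     Put Sat Src One ;; Inc Src ;; Put Dir Edg Src"

text \<open>Tests are strict comparisons only, so a non-root is recognised by comparing it with its
  \<open>Comp\<close> in both orders.\<close>

definition tree_body :: blk where
  "tree_body = Dec Back ;; Get Src Queue Back ;; Get Tmp Comp Src ;;
     Cond Src Tmp settle (Cond Tmp Src settle Nop)"

text \<open>\<open>extra_body\<close> has left \<open>Pos\<close> just behind the input, where the
  output belongs; \<open>Dec\<close> removes the offset of \<open>Dir\<close>.\<close>

definition output_body :: blk where
  "output_body = Get Tmp Dir Edg ;; Dec Tmp ;; Write Pos Tmp ;; Inc Pos ;; Inc Edg"

text \<open>The base \<open>3 * m + 2\<close> leaves \<open>2 + 2 * m\<close> cells for the input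
  and \<open>m\<close> for the output below the arrays.\<close>

definition prelude :: com where
  "prelude = Seq (Const 1 1) (Seq (Load 2 1) (Seq (Const 0 2) (Seq (Add 0 0 2) (Seq (Add 0 0 2) (Add 0 0 2)))))"

definition init_blk :: blk where
  "init_blk = Read NodeCount Pos ;; Inc Pos ;; Read EdgeCount Pos ;; Inc Pos ;; Inc One"

definition reset_blk :: blk where
  "reset_blk = Copy Edg Zero ;; Copy Pos One ;; Inc Pos"

definition main :: com where
  "main = Seq (compile init_blk) (Seq (loop Edg EdgeCount build_body)
     (Seq (loop Start NodeCount search_body) (Seq (compile reset_blk)
     (Seq (loop Edg EdgeCount extra_body) (Seq (loop Zero Back tree_body)
     (Seq (compile (Copy Edg Zero)) (loop Edg EdgeCount output_body)))))))"

text \<open>No loop makes more than \<open>3 * (n + m)\<close> iterations, so this times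
  \<open>3 * (n + m) + 1\<close> bounds the whole run. The 10 covers the final tests of the five
  loops and the single copy.\<close>

definition total_len :: nat where
  "total_len = len init_blk + Suc (len build_body) + Suc (len search_body) + len reset_blk +
     Suc (len extra_body) + Suc (len tree_body) + Suc (len output_body) + 10"


section \<open>Correctness of the algorithm\<close>

locale edge_list =
  fixes n m :: nat and L :: "nat \<Rightarrow> nat"
  assumes L0: "L 0 = n" and L1: "L (Suc 0) = m"
    and end_less: "e < m \<Longrightarrow> L (2 + 2 * e) < n" "e < m \<Longrightarrow> L (3 + 2 * e) < n"
    and end_neq: "e < m \<Longrightarrow> L (2 + 2 * e) \<noteq> L (3 + 2 * e)"
begin

text \<open>Numbering half-edges from 1 puts the start node of \<open>k\<close> into cell
  \<open>k + 1\<close>, for either parity.\<close>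

definition hsrc :: "nat \<Rightarrow> nat" where
  "hsrc k = L (k + 1)"

definition hoth :: "nat \<Rightarrow> nat" where
  "hoth k = (if odd k then L (k + 2) else L k)"

definition rev_half :: "nat \<Rightarrow> nat" where
  "rev_half k = (if odd k then k + 1 else k - 1)"

lemma half_cases:
  assumes "1 \<le> k" "k \<le> 2 * m"
  obtains e where "e < m" "k = 2 * e + 1" | e where "e < m" "k = 2 * e + 2"
proof -
  have "k = 2 * ((k - 1) div 2) + 1 \<or> k = 2 * ((k - 1) div 2) + 2" "(k - 1) div 2 < m"
    using assms by presburger+
  then show ?thesis using that by blast
qed

lemma half_first: "hsrc (2 * e + 1) = L (2 + 2 * e)" "hoth (2 * e + 1) = L (3 + 2 * e)"
  "hsrc (Suc (2 * e)) = L (2 + 2 * e)" "hoth (Suc (2 * e)) = L (3 + 2 * e)"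
  by (simp_all add: hsrc_def hoth_def numeral_3_eq_3)

lemma half_second: "hsrc (2 * e + 2) = L (3 + 2 * e)" "hoth (2 * e + 2) = L (2 + 2 * e)"
  "hsrc (Suc (Suc (2 * e))) = L (3 + 2 * e)" "hoth (Suc (Suc (2 * e))) = L (2 + 2 * e)"
  by (simp_all add: hsrc_def hoth_def numeral_3_eq_3)

lemma half_less: "1 \<le> k \<Longrightarrow> k \<le> 2 * m \<Longrightarrow> hsrc k < n \<and> hoth k < n \<and> hsrc k \<noteq> hoth k"
  by (erule (1) half_cases) (simp_all only: half_first half_second end_less end_neq end_neq[symmetric] simp_thms)

lemma half_ends: "1 \<le> k \<Longrightarrow> k \<le> 2 * m \<Longrightarrow>
  {L (2 + 2 * ((k - 1) div 2)), L (3 + 2 * ((k - 1) div 2))} = {hsrc k, hoth k} \<and> (k - 1) div 2 < m"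
  by (erule (1) half_cases) (auto simp: half_first half_second)

lemma rev_half: "1 \<le> k \<Longrightarrow> k \<le> 2 * m \<Longrightarrow>
  1 \<le> rev_half k \<and> rev_half k \<le> 2 * m \<and> hsrc (rev_half k) = hoth k \<and> hoth (rev_half k) = hsrc k"
  by (erule (1) half_cases) (simp_all add: half_first half_second rev_half_def)

definition frame :: "(var \<Rightarrow> nat) \<Rightarrow> bool" where
  "frame R \<longleftrightarrow> R Zero = 0 \<and> R One = 1 \<and> R NodeCount = n \<and> R EdgeCount = m"

subsection \<open>Adjacency lists\<close>

text \<open>Insertion at the front makes every list strictly decreasing, and the third clause says
  that it omits no half-edge. So while the search shortens the lists, \<open>k\<close> has been
  processed iff the head of its list is below \<open>k\<close>.\<close>

definition cells :: "nat \<Rightarrow> (nat \<Rightarrow> nat) \<Rightarrow> (nat \<Rightarrow> nat) \<Rightarrow> (nat \<Rightarrow> nat) \<Rightarrow> bool" where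
  "cells c nx ot ed \<longleftrightarrow> (\<forall>k. 1 \<le> k \<and> k \<le> c \<longrightarrow>
     nx k < k \<and> (nx k \<noteq> 0 \<longrightarrow> hsrc (nx k) = hsrc k) \<and>
     (\<forall>k'. nx k < k' \<and> k' < k \<longrightarrow> hsrc k' \<noteq> hsrc k) \<and> ot k = hoth k \<and> ed k = (k - 1) div 2)"

text \<open>That is, \<open>f u\<close> is the largest half-edge up to \<open>c\<close> leaving
  \<open>u\<close>, or 0 if there is none.\<close>

definition linked :: "nat \<Rightarrow> (nat \<Rightarrow> nat) \<Rightarrow> bool" where
  "linked c f \<longleftrightarrow> (\<forall>u. f u \<le> c \<and> (f u \<noteq> 0 \<longrightarrow> hsrc (f u) = u)) \<and>
     (\<forall>k. 1 \<le> k \<and> k \<le> c \<longrightarrow> k \<le> f (hsrc k))"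

lemma linked_link:
  "linked c f \<Longrightarrow> hsrc (Suc c) = u \<Longrightarrow> linked (Suc c) (f(u := Suc c))"
  by (auto simp: linked_def le_Suc_eq)

lemma cells_link:
  assumes "cells c nx ot ed" "linked c f" "hsrc (Suc c) = u"
  shows "cells (Suc c) (nx(Suc c := f u)) (ot(Suc c := hoth (Suc c))) (ed(Suc c := c div 2))"
proof -
  have "f u \<le> c" "f u \<noteq> 0 \<Longrightarrow> hsrc (f u) = u"
    using assms(2) unfolding linked_def by auto
  moreover have "hsrc k' \<noteq> u" if "f u < k'" "k' < Suc c" for k'
  proof
    assume "hsrc k' = u"
    moreover have "k' \<le> f (hsrc k')" using assms(2) that unfolding linked_def by simp
    ultimately show False using that by simp
  qed
  ultimately show ?thesis
    using assms(1,3) unfolding cells_def by (auto simp: le_Suc_eq)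
qed

fun build_inv :: "conf \<Rightarrow> bool" where
  "build_inv (R, A, l) \<longleftrightarrow> frame R \<and> l = L \<and> R Edg \<le> m \<and> R Pos = 2 + 2 * R Edg \<and>
     R Half = 2 * R Edg \<and> cells (R Half) (A Next) (A Other) (A EdgeOf) \<and> linked (R Half) (A Head) \<and>
     A Rank = (\<lambda>_. 0) \<and> A InTree = (\<lambda>_. 0) \<and> A Sat = (\<lambda>_. 0) \<and> A Dir = (\<lambda>_. 0) \<and>
     R Front = 0 \<and> R Back = 0 \<and> R Start = 0"

lemma build_step:
  assumes I: "build_inv (R, A, l)" and lt: "R Edg < R EdgeCount"
  shows "build_inv (eff (3 * m + 2) build_body (R, A, l))"
proof -
  define e where "e = R Edg"
  have R: "R Edg = e" "e < m" "R Pos = 2 + 2 * e" "R Half = 2 * e" "l = L"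
      "L (2 + 2 * e) \<noteq> L (3 + 2 * e)"
    using I lt end_neq by (auto simp: e_def frame_def)
  have c: "cells (2 * e) (A Next) (A Other) (A EdgeOf)" and l: "linked (2 * e) (A Head)"
    using I R by auto
  note l1 = linked_link[OF l half_first(3)]
  note c1 = cells_link[OF c l half_first(3), unfolded half_first]
  note l2 = linked_link[OF l1 half_second(3)]
  note c2 = cells_link[OF c1 l1 half_second(3), unfolded half_second]
  show ?thesis
    using I R l2 c2 unfolding build_body_def link_def
    by (simp add: frame_def numeral_3_eq_3)
qed

end

subsection \<open>Breadth-first search\<close>

text \<open>\<open>qh\<close>, \<open>qt\<close>, \<open>r\<close> are the values of
  \<open>Front\<close>, \<open>Back\<close>, \<open>Start\<close>. \<open>Head\<close> is consumed
  by the search, whence the comparison in \<open>processed\<close>. \<open>comp_queue\<close> holds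
  because a root is enqueued only into an empty queue; \<open>finished\<close> lets the loop test
  \<open>Start\<close> alone.\<close>

locale search_state = edge_list n m L for n m L +
  fixes A :: "arr \<Rightarrow> nat \<Rightarrow> nat" and qh qt r :: nat
  assumes cells: "cells (2 * m) (A Next) (A Other) (A EdgeOf)"
    and head_le: "A Head u \<le> 2 * m"
    and hsrc_head: "A Head u \<noteq> 0 \<Longrightarrow> hsrc (A Head u) = u"
    and qh_le: "qh \<le> qt" and qt_le: "qt \<le> n" and r_le: "r \<le> n"
    and finished: "r = n \<Longrightarrow> qh = qt"
    and before_start: "v < r \<Longrightarrow> A Rank v \<noteq> 0"
    and queue: "i < qt \<Longrightarrow> A Queue i < n \<and> A Rank (A Queue i) = Suc i"
    and rank: "A Rank v \<noteq> 0 \<Longrightarrow> v < n \<and> A Rank v \<le> qt \<and> A Queue (A Rank v - 1) = v"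
    and head_dequeued: "i < qh \<Longrightarrow> A Head (A Queue i) = 0"
    and comp_queue: "qh \<le> i \<Longrightarrow> i < qt \<Longrightarrow> qh \<le> j \<Longrightarrow> j < qt \<Longrightarrow>
      A Comp (A Queue i) = A Comp (A Queue j)"
    and processed: "1 \<le> k \<Longrightarrow> k \<le> 2 * m \<Longrightarrow> A Head (hsrc k) < k \<Longrightarrow>
      A Rank (hsrc k) \<noteq> 0 \<and> A Rank (hoth k) \<noteq> 0 \<and> A Comp (hoth k) = A Comp (hsrc k)"
    and rank_comp: "A Rank v \<noteq> 0 \<Longrightarrow> A Rank (A Comp v) \<noteq> 0"
    and tree: "A Rank v \<noteq> 0 \<Longrightarrow> A Comp v \<noteq> v \<Longrightarrow>
      A ParEdge v < m \<and> {L (2 + 2 * A ParEdge v), L (3 + 2 * A ParEdge v)} = {v, A Parent v} \<and>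
      A Rank (A Parent v) \<noteq> 0 \<and> A Rank (A Parent v) < A Rank v \<and>
      A Comp (A Parent v) = A Comp v \<and> A InTree (A ParEdge v) \<noteq> 0"
    and in_tree: "A InTree e \<noteq> 0 \<Longrightarrow> \<exists>v. A Rank v \<noteq> 0 \<and> A Comp v \<noteq> v \<and> A ParEdge v = e"
begin

text \<open>\<open>Rank\<close> inverts \<open>Queue\<close>, so the queue has no repetitions; it
  misses \<open>w\<close>, so a place is free.\<close>

lemma qt_less:
  assumes "w < n" "A Rank w = 0"
  shows "qt < n"
proof -
  have "inj_on (A Queue) {..<qt}"
    by (rule inj_on_inverseI[where g = "\<lambda>v. A Rank v - 1"]) (simp add: queue)
  moreover have "A Queue ` {..<qt} \<subseteq> {..<n} - {w}"
    using queue assms(2) by fastforce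
  ultimately have "card {..<qt} \<le> card ({..<n} - {w})"
    by (intro card_inj_on_le) auto
  with assms(1) show ?thesis by simp
qed

text \<open>As lists omit nothing, advancing the head from \<open>c\<close> makes only
  \<open>c\<close> itself newly processed.\<close>

lemma processed_pop:
  assumes "A Queue qh = u" "A Head u = c" "c \<noteq> 0"
    and k: "1 \<le> k" "k \<le> 2 * m" "((A Head)(u := A Next c)) (hsrc k) < k" "k \<noteq> c"
  shows "A Rank (hsrc k) \<noteq> 0 \<and> A Rank (hoth k) \<noteq> 0 \<and> A Comp (hoth k) = A Comp (hsrc k)"
proof -
  have "A Head (hsrc k) < k"
  proof (cases "hsrc k = u")
    case True
    have "hsrc c = u" "1 \<le> c" "c \<le> 2 * m"
      using head_le[of u] hsrc_head[of u] assms(2,3) by auto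
    then have "\<not> k < c"
      using cells True k(3) unfolding cells_def by force
    then show ?thesis using True assms(2) k(4) by simp
  qed (use k(3) in simp)
  then show ?thesis using processed k by blast
qed

text \<open>An unvisited node is neither the parent nor the root of a visited one, so the entries
  written at \<open>w\<close> disturb no other node. \<open>A'\<close> is given array by array to be
  independent of the order of the stores.\<close>

lemma search_state_visit:
  assumes q: "qh < qt" "A Queue qh = u" "A Head u = c" "c \<noteq> 0" and w: "hoth c = w" "A Rank w = 0"
    and A': "A' Head = (A Head)(u := A Next c)" "A' ParEdge = (A ParEdge)(w := (c - 1) div 2)"
      "A' Parent = (A Parent)(w := u)" "A' InTree = (A InTree)((c - 1) div 2 := 1)"
      "A' Comp = (A Comp)(w := A Comp u)" "A' Queue = (A Queue)(qt := w)"
      "A' Rank = (A Rank)(w := Suc qt)"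
      "A' Next = A Next" "A' Other = A Other" "A' EdgeOf = A EdgeOf"
  shows "search_state n m L A' qh (Suc qt) r"
proof -
  have u: "A Rank u = Suc qh" "u < n" using queue q by auto
  have c: "1 \<le> c" "c \<le> 2 * m" "hsrc c = u" using head_le[of u] hsrc_head[of u] q by auto
  have wn: "w < n" "w \<noteq> u" using half_less[OF c(1,2)] c w by auto
  have ends: "{L (2 + 2 * ((c - 1) div 2)), L (3 + 2 * ((c - 1) div 2))} = {w, u}" "(c - 1) div 2 < m"
    using half_ends[OF c(1,2)] c w by auto
  have nxt: "A Next c < c" "A Next c \<noteq> 0 \<Longrightarrow> hsrc (A Next c) = u"
    using cells c unfolding cells_def by auto
  have comp_u: "A Comp u \<noteq> w" using rank_comp[of u] u w by auto
  have par_w: "A Parent v \<noteq> w \<and> A Comp v \<noteq> w" if "A Rank v \<noteq> 0" "A Comp v \<noteq> v" for v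
    using tree[OF that] rank_comp[OF that(1)] w by auto
  show ?thesis
  proof
    show "cells (2 * m) (A' Next) (A' Other) (A' EdgeOf)" using cells A' by simp
    show "A' Head x \<le> 2 * m" for x using head_le[of x] nxt c A' by auto
    show "A' Head x \<noteq> 0 \<Longrightarrow> hsrc (A' Head x) = x" for x using hsrc_head[of x] nxt A' by auto
    show "qh \<le> Suc qt" "Suc qt \<le> n" "r \<le> n"
      using qh_le qt_less[OF wn(1) w(2)] r_le by auto
    show "r = n \<Longrightarrow> qh = Suc qt" using finished q by simp
    show "v < r \<Longrightarrow> A' Rank v \<noteq> 0" for v using before_start A' by simp
    show "i < Suc qt \<Longrightarrow> A' Queue i < n \<and> A' Rank (A' Queue i) = Suc i" for i
      using queue[of i] wn w A' by (auto simp: less_Suc_eq)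
    show "A' Rank v \<noteq> 0 \<Longrightarrow> v < n \<and> A' Rank v \<le> Suc qt \<and> A' Queue (A' Rank v - 1) = v" for v
      using rank[of v] wn A' by auto
    show "i < qh \<Longrightarrow> A' Head (A' Queue i) = 0" for i
      using head_dequeued[of i] queue[of i] u q A' by auto
    \<comment> \<open>\<open>w\<close> inherits the label of \<open>u\<close>, which still waits at
      position \<open>qh\<close> and shares it with the whole queue.\<close>
    show "qh \<le> i \<Longrightarrow> i < Suc qt \<Longrightarrow> qh \<le> j \<Longrightarrow> j < Suc qt \<Longrightarrow>
        A' Comp (A' Queue i) = A' Comp (A' Queue j)" for i j
      using comp_queue[of i j] comp_queue[of i qh] comp_queue[of qh j] queue[of i] queue[of j] w q A'
      by (auto simp: less_Suc_eq)
    show "A' Rank (hsrc k) \<noteq> 0 \<and> A' Rank (hoth k) \<noteq> 0 \<and> A' Comp (hoth k) = A' Comp (hsrc k)"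
      if k: "1 \<le> k" "k \<le> 2 * m" "A' Head (hsrc k) < k" for k
    proof (cases "k = c")
      case True
      then show ?thesis using c w u wn A' by simp
    next
      case False
      from processed_pop[OF q(2-4) k(1,2) _ False] k(3) A' w show ?thesis by auto
    qed
    show "A' Rank v \<noteq> 0 \<Longrightarrow> A' Rank (A' Comp v) \<noteq> 0" for v
      using rank_comp[of v] rank_comp[of u] u A' by auto
    show "A' Rank v \<noteq> 0 \<Longrightarrow> A' Comp v \<noteq> v \<Longrightarrow>
      A' ParEdge v < m \<and> {L (2 + 2 * A' ParEdge v), L (3 + 2 * A' ParEdge v)} = {v, A' Parent v} \<and>
      A' Rank (A' Parent v) \<noteq> 0 \<and> A' Rank (A' Parent v) < A' Rank v \<and>
      A' Comp (A' Parent v) = A' Comp v \<and> A' InTree (A' ParEdge v) \<noteq> 0" for v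
    proof (cases "v = w")
      case True
      then show ?thesis using ends u q wn A' by simp
    next
      case False
      moreover assume "A' Rank v \<noteq> 0" "A' Comp v \<noteq> v"
      ultimately show ?thesis using tree[of v] par_w[of v] A' by simp
    qed
    show "\<exists>v. A' Rank v \<noteq> 0 \<and> A' Comp v \<noteq> v \<and> A' ParEdge v = e" if e: "A' InTree e \<noteq> 0" for e
    proof (cases "e = (c - 1) div 2")
      case True
      then show ?thesis using comp_u A' by (intro exI[of _ w]) simp
    next
      case False
      with e obtain v where "A Rank v \<noteq> 0" "A Comp v \<noteq> v" "A ParEdge v = e"
        using in_tree[of e] A' by auto
      then show ?thesis using A' w by (intro exI[of _ v]) auto
    qed
  qed
qed

text \<open>A visited neighbour lies in the same tree: either it is still in the queue, or the reverse
  half-edge has been processed.\<close>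

lemma search_state_skip:
  assumes q: "qh < qt" "A Queue qh = u" "A Head u = c" "c \<noteq> 0" and w: "A Rank (hoth c) \<noteq> 0"
    and A': "A' = A(Head := (A Head)(u := A Next c))"
  shows "search_state n m L A' qh qt r"
proof -
  have u: "A Rank u = Suc qh" "u < n" using queue q by auto
  have c: "1 \<le> c" "c \<le> 2 * m" "hsrc c = u" using head_le[of u] hsrc_head[of u] q by auto
  have nxt: "A Next c < c" "A Next c \<noteq> 0 \<Longrightarrow> hsrc (A Next c) = u"
    using cells c unfolding cells_def by auto
  have eqs: "A' Next = A Next" "A' Other = A Other" "A' EdgeOf = A EdgeOf" "A' Rank = A Rank"
      "A' Queue = A Queue" "A' Comp = A Comp" "A' ParEdge = A ParEdge" "A' Parent = A Parent"
      "A' InTree = A InTree"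
    by (simp_all add: A')
  have comp: "A Comp (hoth c) = A Comp u"
  proof (cases "A Rank (hoth c) \<le> qh")
    case True
    with w have "A Head (A Queue (A Rank (hoth c) - 1)) = 0"
      using head_dequeued by simp
    then have "A Head (hoth c) = 0" using rank[OF w] by simp
    then show ?thesis
      using processed[of "rev_half c"] rev_half[OF c(1,2)] c by simp
  next
    case False
    with comp_queue[of "A Rank (hoth c) - 1" qh] rank[OF w] q w show ?thesis by auto
  qed
  show ?thesis
  proof
    show "A' Head x \<le> 2 * m" for x using head_le[of x] nxt c A' by auto
    show "A' Head x \<noteq> 0 \<Longrightarrow> hsrc (A' Head x) = x" for x using hsrc_head[of x] nxt A' by auto
    show "i < qh \<Longrightarrow> A' Head (A' Queue i) = 0" for i
      using head_dequeued[of i] queue[of i] u q A' by auto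
    show "A' Rank (hsrc k) \<noteq> 0 \<and> A' Rank (hoth k) \<noteq> 0 \<and> A' Comp (hoth k) = A' Comp (hsrc k)"
      if k: "1 \<le> k" "k \<le> 2 * m" "A' Head (hsrc k) < k" for k
    proof (cases "k = c")
      case True
      then show ?thesis using c w u comp A' by simp
    next
      case False
      from processed_pop[OF q(2-4) k(1,2) _ False] k(3) A' show ?thesis by auto
    qed
  qed (unfold eqs, (rule cells qh_le qt_le r_le finished before_start queue rank comp_queue
      rank_comp tree in_tree; assumption)+)
qed

lemma search_state_dequeue:
  assumes "qh < qt" "A Head (A Queue qh) = 0"
  shows "search_state n m L A (Suc qh) qt r"
proof
  show "i < Suc qh \<Longrightarrow> A Head (A Queue i) = 0" for i
    using head_dequeued[of i] assms by (auto simp: less_Suc_eq)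
  show "r = n \<Longrightarrow> Suc qh = qt" using finished assms by simp
qed (use cells head_le hsrc_head assms qt_le r_le before_start queue rank comp_queue processed
    rank_comp tree in_tree in auto)

lemma search_state_next:
  assumes "qh = qt" "r < n" "A Rank r \<noteq> 0"
  shows "search_state n m L A qh qt (Suc r)"
proof
  show "v < Suc r \<Longrightarrow> A Rank v \<noteq> 0" for v
    using before_start[of v] assms by (auto simp: less_Suc_eq)
  show "Suc r \<le> n" using assms by simp
qed (use cells head_le hsrc_head assms qh_le qt_le queue rank head_dequeued comp_queue processed
    rank_comp tree in_tree in auto)

text \<open>The queue being empty, the root is the only waiting node and may start a new
  label.\<close>

lemma search_state_root:
  assumes r: "qh = qt" "r < n" "A Rank r = 0"
    and A': "A' Comp = (A Comp)(r := r)" "A' Queue = (A Queue)(qt := r)" "A' Rank = (A Rank)(r := Suc qt)"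
      "A' Head = A Head" "A' ParEdge = A ParEdge" "A' Parent = A Parent" "A' InTree = A InTree"
      "A' Next = A Next" "A' Other = A Other" "A' EdgeOf = A EdgeOf"
  shows "search_state n m L A' qh (Suc qt) r"
proof
  show "cells (2 * m) (A' Next) (A' Other) (A' EdgeOf)" using cells A' by simp
  show "A' Head x \<le> 2 * m" for x using head_le[of x] A' by auto
  show "A' Head x \<noteq> 0 \<Longrightarrow> hsrc (A' Head x) = x" for x using hsrc_head[of x] A' by auto
  show "qh \<le> Suc qt" "Suc qt \<le> n" "r \<le> n"
    using qh_le qt_less[OF r(2,3)] r_le by auto
  show "r = n \<Longrightarrow> qh = Suc qt" using r by simp
  show "v < r \<Longrightarrow> A' Rank v \<noteq> 0" for v using before_start A' by simp
  show "i < Suc qt \<Longrightarrow> A' Queue i < n \<and> A' Rank (A' Queue i) = Suc i" for i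
    using queue[of i] r A' by (auto simp: less_Suc_eq)
  show "A' Rank v \<noteq> 0 \<Longrightarrow> v < n \<and> A' Rank v \<le> Suc qt \<and> A' Queue (A' Rank v - 1) = v" for v
    using rank[of v] r A' by auto
  show "i < qh \<Longrightarrow> A' Head (A' Queue i) = 0" for i
    using head_dequeued[of i] queue[of i] r A' by auto
  show "qh \<le> i \<Longrightarrow> i < Suc qt \<Longrightarrow> qh \<le> j \<Longrightarrow> j < Suc qt \<Longrightarrow>
      A' Comp (A' Queue i) = A' Comp (A' Queue j)" for i j
    using r by (auto simp: less_Suc_eq)
  show "A' Rank (hsrc k) \<noteq> 0 \<and> A' Rank (hoth k) \<noteq> 0 \<and> A' Comp (hoth k) = A' Comp (hsrc k)"
    if k: "1 \<le> k" "k \<le> 2 * m" "A' Head (hsrc k) < k" for k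
    using processed[of k] r k A' by auto
  show "A' Rank v \<noteq> 0 \<Longrightarrow> A' Rank (A' Comp v) \<noteq> 0" for v
    using rank_comp[of v] A' by auto
  show "A' Rank v \<noteq> 0 \<Longrightarrow> A' Comp v \<noteq> v \<Longrightarrow>
    A' ParEdge v < m \<and> {L (2 + 2 * A' ParEdge v), L (3 + 2 * A' ParEdge v)} = {v, A' Parent v} \<and>
    A' Rank (A' Parent v) \<noteq> 0 \<and> A' Rank (A' Parent v) < A' Rank v \<and>
    A' Comp (A' Parent v) = A' Comp v \<and> A' InTree (A' ParEdge v) \<noteq> 0" for v
    using tree[of v] rank[of v] r A' by (cases "v = r") auto
  show "A' InTree e \<noteq> 0 \<Longrightarrow> \<exists>v. A' Rank v \<noteq> 0 \<and> A' Comp v \<noteq> v \<and> A' ParEdge v = e" for e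
  proof -
    assume "A' InTree e \<noteq> 0"
    then obtain v where "A Rank v \<noteq> 0" "A Comp v \<noteq> v" "A ParEdge v = e"
      using in_tree[of e] A' by auto
    then show ?thesis using A' r by (intro exI[of _ v]) auto
  qed
qed

end

context edge_list
begin

fun search_inv :: "conf \<Rightarrow> bool" where
  "search_inv (R, A, l) \<longleftrightarrow> frame R \<and> l = L \<and> A Sat = (\<lambda>_. 0) \<and> A Dir = (\<lambda>_. 0) \<and>
     search_state n m L A (R Front) (R Back) (R Start)"

text \<open>The half-edges still pending, plus what is left for each of the three counters. Every
  iteration lowers some summand and raises none, so scanning all lists costs \<open>2 * m\<close> in
  total, not per node.\<close>

fun search_pot :: "conf \<Rightarrow> nat" where
  "search_pot (R, A, l) = card {k \<in> {1..2 * m}. k \<le> A Head (hsrc k)} +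
     (n - R Front) + (n - R Back) + (n - R Start)"

lemma search_inv_start:
  assumes "build_inv (R, A, l)" "\<not> R Edg < R EdgeCount"
  shows "search_inv (R, A, l)" "search_pot (R, A, l) \<le> 2 * m + 3 * n"
proof -
  have "card {k \<in> {1..2 * m}. k \<le> A Head (hsrc k)} \<le> card {1..2 * m}"
    by (intro card_mono) auto
  then show "search_pot (R, A, l) \<le> 2 * m + 3 * n" by simp
  have R: "R Edg = m" "R Half = 2 * m" using assms by (auto simp: frame_def)
  have "\<not> A Head (hsrc k) < k" if "k \<le> 2 * m" for k
    using assms(1) R that by (cases "k = 0") (auto simp: linked_def not_less)
  then have "search_state n m L A 0 0 0"
    by unfold_locales (use assms R in \<open>auto simp: linked_def\<close>)
  then show "search_inv (R, A, l)" using assms by simp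
qed

lemma search_step:
  assumes I: "search_inv (R, A, l)" and lt: "R Start < R NodeCount"
  shows "search_inv (eff b search_body (R, A, l)) \<and>
    search_pot (eff b search_body (R, A, l)) < search_pot (R, A, l)"
proof -
  have R: "R Zero = 0" "R One = 1" "R Start < n" "frame R" "l = L" "A Sat = (\<lambda>_. 0)" "A Dir = (\<lambda>_. 0)"
    using I lt by (auto simp: frame_def)
  interpret search_state n m L A "R Front" "R Back" "R Start" using I by simp
  show ?thesis
  proof (cases "R Front < R Back")
    case False
    then have q: "R Front = R Back" using qh_le by simp
    show ?thesis
    proof (cases "A Rank (R Start) = 0")
      case True
      have "R Back < n" using qt_less True R by blast
      with search_state_root[OF q R(3) True] show ?thesis
        using q R True by (auto simp: search_body_def frame_def)
    next
      case False
      with search_state_next[OF q R(3)] show ?thesis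
        using q R by (auto simp: search_body_def frame_def)
    qed
  next
    case lt: True
    define u where "u = A Queue (R Front)"
    define c where "c = A Head u"
    show ?thesis
    proof (cases "c = 0")
      case True
      have "R Front < n" using lt qt_le by simp
      with search_state_dequeue[OF lt] show ?thesis
        using lt R True by (auto simp: search_body_def frame_def u_def c_def)
    next
      case False
      have c: "1 \<le> c" "c \<le> 2 * m" "hsrc c = u"
        using head_le[of u] hsrc_head[of u] False by (auto simp: c_def)
      then have cell: "A Next c < c" "A Other c = hoth c" "A EdgeOf c = (c - 1) div 2"
        using cells unfolding cells_def by auto
      \<comment> \<open>Advancing the head removes \<open>c\<close> from the pending half-edges,
        which pays for the iteration whether or not a node is discovered.\<close>
      have "{k \<in> {1..2 * m}. k \<le> ((A Head)(u := A Next c)) (hsrc k)} \<subset>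
          {k \<in> {1..2 * m}. k \<le> A Head (hsrc k)}"
      proof (rule psubsetI)
        show "{k \<in> {1..2 * m}. k \<le> ((A Head)(u := A Next c)) (hsrc k)} \<subseteq>
            {k \<in> {1..2 * m}. k \<le> A Head (hsrc k)}"
          using cell(1) by (auto simp: c_def split: if_splits)
        have "c \<in> {k \<in> {1..2 * m}. k \<le> A Head (hsrc k)}" using c by (simp add: c_def)
        moreover have "c \<notin> {k \<in> {1..2 * m}. k \<le> ((A Head)(u := A Next c)) (hsrc k)}"
          using c cell by simp
        ultimately show "{k \<in> {1..2 * m}. k \<le> ((A Head)(u := A Next c)) (hsrc k)} \<noteq>
            {k \<in> {1..2 * m}. k \<le> A Head (hsrc k)}" by blast
      qed
      then have less: "card {k \<in> {1..2 * m}. k \<le> ((A Head)(u := A Next c)) (hsrc k)} <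
          card {k \<in> {1..2 * m}. k \<le> A Head (hsrc k)}"
        by (rule psubset_card_mono[rotated]) simp
      have q: "A Queue (R Front) = u" "A Head u = c" by (simp_all add: u_def c_def)
      show ?thesis
      proof (cases "A Rank (hoth c) = 0")
        case True
        define s where "s = eff b search_body (R, A, l)"
        obtain R' A' where s: "s = (R', A', l)" "frame R'" "A' Sat = (\<lambda>_. 0)" "A' Dir = (\<lambda>_. 0)"
            "R' Front = R Front" "R' Back = Suc (R Back)" "R' Start = R Start"
          and A': "A' Head = (A Head)(u := A Next c)" "A' ParEdge = (A ParEdge)(hoth c := (c - 1) div 2)"
            "A' Parent = (A Parent)(hoth c := u)" "A' InTree = (A InTree)((c - 1) div 2 := 1)"
            "A' Comp = (A Comp)(hoth c := A Comp u)" "A' Queue = (A Queue)(R Back := hoth c)"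
            "A' Rank = (A Rank)(hoth c := Suc (R Back))"
            "A' Next = A Next" "A' Other = A Other" "A' EdgeOf = A EdgeOf"
          using lt R True False cell q unfolding s_def search_body_def
          by (simp add: frame_def)
        have "search_state n m L A' (R Front) (Suc (R Back)) (R Start)"
          by (rule search_state_visit[OF lt q False refl True A'])
        with s have "search_inv s" using R by simp
        moreover have "search_pot s < search_pot (R, A, l)"
          using less s(1,5-7) A'(1) by simp
        ultimately show ?thesis by (simp add: s_def)
      next
        case w: False
        from search_state_skip[OF lt q False w refl] less show ?thesis
          using lt R w False cell q by (simp add: search_body_def frame_def)
      qed
    qed
  qed
qed

end

subsection \<open>Directing the edges\<close>

text \<open>The result of the search without its counters. Smaller rank of the parent makes the
  reversed queue a leaf-to-root order and gives the induction towards the root.\<close>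

locale spanning_forest = edge_list n m L for n m L +
  fixes A :: "arr \<Rightarrow> nat \<Rightarrow> nat"
  assumes queue: "i < n \<Longrightarrow> A Queue i < n \<and> A Rank (A Queue i) = Suc i"
    and rank: "v < n \<Longrightarrow> A Rank v \<noteq> 0 \<and> A Rank v \<le> n \<and> A Queue (A Rank v - 1) = v"
    and comp_ends: "e < m \<Longrightarrow> A Comp (L (2 + 2 * e)) = A Comp (L (3 + 2 * e))"
    and tree: "v < n \<Longrightarrow> A Comp v \<noteq> v \<Longrightarrow>
      A ParEdge v < m \<and> {L (2 + 2 * A ParEdge v), L (3 + 2 * A ParEdge v)} = {v, A Parent v} \<and>
      A Parent v < n \<and> A Rank (A Parent v) < A Rank v \<and>
      A Comp (A Parent v) = A Comp v \<and> A InTree (A ParEdge v) \<noteq> 0"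
    and in_tree: "A InTree e \<noteq> 0 \<Longrightarrow> \<exists>v<n. A Comp v \<noteq> v \<and> A ParEdge v = e"
begin

text \<open>Two nodes sharing a parent edge would be parents of each other, against the
  ranks.\<close>

lemma par_edge_inj:
  assumes "v < n" "A Comp v \<noteq> v" "w < n" "A Comp w \<noteq> w" "A ParEdge v = A ParEdge w"
  shows "v = w"
proof (rule ccontr)
  assume "v \<noteq> w"
  moreover have "{v, A Parent v} = {w, A Parent w}"
    using tree[OF assms(1,2)] tree[OF assms(3,4)] assms(5) by simp
  ultimately have "A Parent v = w" "A Parent w = v" by (auto simp: doubleton_eq_iff)
  then show False using tree[OF assms(1,2)] tree[OF assms(3,4)] by simp
qed

text \<open>\<open>dir\<close> vanishes outside the edges, so the existential in the second clause
  can do without a bound.\<close>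

definition directed :: "(nat \<Rightarrow> nat) \<Rightarrow> (nat \<Rightarrow> nat) \<Rightarrow> bool" where
  "directed sat dir \<longleftrightarrow>
     (\<forall>e. dir e \<noteq> 0 \<longrightarrow> e < m \<and> dir e \<in> {Suc (L (2 + 2 * e)), Suc (L (3 + 2 * e))}) \<and>
     (\<forall>v. sat v \<noteq> 0 \<longleftrightarrow> (\<exists>e. dir e = Suc v))"

text \<open>Since \<open>e\<close> was undirected, no node loses an edge.\<close>

lemma directed_update:
  assumes "directed sat dir" "e < m" "dir e = 0" "t \<in> {L (2 + 2 * e), L (3 + 2 * e)}"
  shows "directed (sat(t := 1)) (dir(e := Suc t))"
proof -
  have "(\<exists>e'. (dir(e := Suc t)) e' = Suc v) \<longleftrightarrow> v = t \<or> (\<exists>e'. dir e' = Suc v)" for v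
    using assms(3) by (metis Suc_inject fun_upd_other fun_upd_same old.nat.distinct(2))
  then show ?thesis using assms unfolding directed_def by auto
qed

text \<open>The nodes of rank above \<open>i\<close> have been treated. The last clause says that a node that
  does not need its parent edge leaves it to its parent.\<close>

definition settled :: "nat \<Rightarrow> (nat \<Rightarrow> nat) \<Rightarrow> (nat \<Rightarrow> nat) \<Rightarrow> bool" where
  "settled i sat dir \<longleftrightarrow> directed sat dir \<and> (\<forall>e<m. A InTree e = 0 \<longrightarrow> dir e \<noteq> 0) \<and>
     (\<forall>v<n. A Comp v \<noteq> v \<longrightarrow> (A Rank v \<le> i \<longrightarrow> dir (A ParEdge v) = 0) \<and>
       (i < A Rank v \<longrightarrow> dir (A ParEdge v) \<noteq> 0 \<and> sat v \<noteq> 0 \<and>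
         (\<forall>e. e \<noteq> A ParEdge v \<longrightarrow> dir e = Suc v \<longrightarrow> dir (A ParEdge v) = Suc (A Parent v))))"

lemma rank_eq_iff: "v < n \<Longrightarrow> i < n \<Longrightarrow> A Rank v = Suc i \<longleftrightarrow> v = A Queue i"
  using rank[of v] queue[of i] by auto

lemma settled_root:
  assumes "settled (Suc i) sat dir" "i < n" "A Comp (A Queue i) = A Queue i"
  shows "settled i sat dir"
proof -
  have "(A Rank v \<le> i \<longleftrightarrow> A Rank v \<le> Suc i) \<and> (i < A Rank v \<longleftrightarrow> Suc i < A Rank v)" if "v < n" "A Comp v \<noteq> v" for v
    using rank_eq_iff[OF that(1) assms(2)] that(2) assms(3) by (auto simp: le_Suc_eq)
  then show ?thesis using assms(1) unfolding settled_def by simp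
qed

lemma settled_step:
  assumes S: "settled (Suc i) sat dir" and v: "i < n" "v = A Queue i" "A Comp v \<noteq> v"
    and t: "t = (if sat v = 0 then v else A Parent v)"
  shows "settled i (sat(t := 1)) (dir(A ParEdge v := Suc t))"
proof -
  define e where "e = A ParEdge v"
  have vn: "v < n" "A Rank v = Suc i" using queue v by auto
  note T = tree[OF vn(1) v(3)]
  have dir: "directed sat dir" and e0: "dir e = 0"
    using S v(3) vn unfolding settled_def by (auto simp: e_def)
  \<comment> \<open>The target is \<open>v\<close> or its parent, hence not treated earlier; treated
    nodes receive no further edge and keep their clauses.\<close>
  have tr: "t \<in> {v, A Parent v}" "A Rank t \<le> Suc i"
    using t T vn by auto
  have "A InTree e' = 0 \<Longrightarrow> e' < m \<Longrightarrow> (dir(e := Suc t)) e' \<noteq> 0" for e'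
    using S unfolding settled_def by auto
  moreover have "directed (sat(t := 1)) (dir(e := Suc t))"
  proof (rule directed_update[OF dir _ e0])
    have "{L (2 + 2 * e), L (3 + 2 * e)} = {v, A Parent v}" using T by (simp only: e_def)
    then show "t \<in> {L (2 + 2 * e), L (3 + 2 * e)}" using tr(1) by (simp only:)
  qed (simp add: e_def T)
  moreover have "(A Rank w \<le> i \<longrightarrow> (dir(e := Suc t)) (A ParEdge w) = 0) \<and>
       (i < A Rank w \<longrightarrow> (dir(e := Suc t)) (A ParEdge w) \<noteq> 0 \<and> (sat(t := 1)) w \<noteq> 0 \<and>
         (\<forall>e'. e' \<noteq> A ParEdge w \<longrightarrow> (dir(e := Suc t)) e' = Suc w \<longrightarrow>
           (dir(e := Suc t)) (A ParEdge w) = Suc (A Parent w)))"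
    if w: "w < n" "A Comp w \<noteq> w" for w
  proof (cases "w = v")
    case True
    \<comment> \<open>A node that takes its parent edge is reached by no other, so the last clause
      of \<open>settled\<close> is vacuous for it.\<close>
    have "dir e' \<noteq> Suc v" if "sat v = 0" for e'
      using dir that unfolding directed_def by blast
    then show ?thesis using True vn t by (auto simp: e_def)
  next
    case False
    then have e: "A ParEdge w \<noteq> e" using par_edge_inj[OF w vn(1) v(3)] by (auto simp: e_def)
    have "A Rank w \<noteq> Suc i" using rank_eq_iff[OF w(1) v(1)] False v(2) by simp
    moreover have "t \<noteq> w" if "Suc i < A Rank w" using tr(2) that by auto
    ultimately show ?thesis
      using S w e unfolding settled_def by (auto simp: le_Suc_eq)
  qed
  ultimately show ?thesis unfolding settled_def e_def by simp
qed

text \<open>If some edge of a tree's component is not the parent edge of the node it is directed to, this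
  node has left its own parent edge to its parent; by induction along the path, the root is
  satisfied.\<close>

lemma root_satisfied:
  assumes S: "settled 0 sat dir"
  shows "v < n \<Longrightarrow> dir e = Suc v \<Longrightarrow> A Comp v = v \<or> e \<noteq> A ParEdge v \<Longrightarrow> \<exists>e'. dir e' = Suc (A Comp v)"
proof (induction "A Rank v" arbitrary: v e rule: less_induct)
  case less
  show ?case
  proof (cases "A Comp v = v")
    case True
    then show ?thesis using less.prems(2) by auto
  next
    case False
    have P: "A Parent v < n" "A Rank (A Parent v) < A Rank v" "A Comp (A Parent v) = A Comp v"
      using tree[OF less.prems(1) False] by blast+
    have d: "dir (A ParEdge v) = Suc (A Parent v)"
    proof -
      have "0 < A Rank v" using rank[OF less.prems(1)] by simp
      with S less.prems(1) False have "\<forall>e. e \<noteq> A ParEdge v \<longrightarrow> dir e = Suc v \<longrightarrow>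
          dir (A ParEdge v) = Suc (A Parent v)"
        unfolding settled_def by blast
      then show ?thesis using less.prems(2,3) False by blast
    qed
    \<comment> \<open>The edge received from \<open>v\<close> is not the parent's own parent edge,
      so it is a surplus there too.\<close>
    have "A Comp (A Parent v) = A Parent v \<or> A ParEdge v \<noteq> A ParEdge (A Parent v)"
      using par_edge_inj[OF less.prems(1) False P(1)] P(2) by (metis less_irrefl)
    from less.hyps[OF P(2,1) d this] show ?thesis unfolding P(3) .
  qed
qed

lemma settled_certificate:
  assumes S: "settled 0 sat dir"
  shows "e < m \<Longrightarrow> dir e \<in> {Suc (L (2 + 2 * e)), Suc (L (3 + 2 * e))}"
    and "v < n \<Longrightarrow> \<forall>e<m. dir e \<noteq> Suc v \<Longrightarrow> A Comp v = v"
    and "v < n \<Longrightarrow> \<forall>e<m. dir e \<noteq> Suc v \<Longrightarrow>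
      inj_on (\<lambda>e. dir e - 1) {e \<in> {..<m}. A Comp (dir e - 1) = v}"
proof -
  have dir: "directed sat dir" using S by (simp add: settled_def)
  have ends: "dir e \<in> {Suc (L (2 + 2 * e)), Suc (L (3 + 2 * e))}" if "e < m" for e
  proof -
    \<comment> \<open>A forest edge is the parent edge of some node, and every node has been treated
      because ranks are positive.\<close>
    have "dir e \<noteq> 0"
    proof (cases "A InTree e = 0")
      case True
      then show ?thesis using S that unfolding settled_def by blast
    next
      case False
      then obtain v where "v < n" "A Comp v \<noteq> v" "A ParEdge v = e" using in_tree by blast
      then show ?thesis using S rank[of v] unfolding settled_def by auto
    qed
    then show ?thesis using dir unfolding directed_def by blast
  qed
  then show "e < m \<Longrightarrow> dir e \<in> {Suc (L (2 + 2 * e)), Suc (L (3 + 2 * e))}" .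
  assume v: "v < n" "\<forall>e<m. dir e \<noteq> Suc v"
  then have none: "dir e \<noteq> Suc v" for e
    using dir unfolding directed_def by (metis old.nat.distinct(2))
  show "A Comp v = v"
  proof (rule ccontr)
    assume "A Comp v \<noteq> v"
    then have "sat v \<noteq> 0" using S v(1) rank[of v] unfolding settled_def by auto
    then show False using dir none unfolding directed_def by blast
  qed
  \<comment> \<open>Otherwise \<open>e\<close> would be a surplus edge and
    \<open>root_satisfied\<close> would satisfy \<open>v\<close>. Thus \<open>A ParEdge\<close> is a
    left inverse, which gives injectivity.\<close>
  have own: "A Comp (dir e - 1) \<noteq> dir e - 1 \<and> e = A ParEdge (dir e - 1) \<and> dir e - 1 < n"
    if e: "e < m" "A Comp (dir e - 1) = v" for e
  proof -
    have d: "dir e = Suc (dir e - 1)" "dir e - 1 < n" using ends[OF e(1)] end_less[OF e(1)] by auto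
    then show ?thesis using root_satisfied[OF S d(2,1)] none e(2) by auto
  qed
  show "inj_on (\<lambda>e. dir e - 1) {e \<in> {..<m}. A Comp (dir e - 1) = v}"
    by (rule inj_on_inverseI[where g = "A ParEdge"])
      (rule own[THEN conjunct2, THEN conjunct1, symmetric]; simp)
qed

end

section \<open>From the finished search to a certified orientation\<close>

context edge_list
begin

text \<open>All nodes are visited, so the queue holds all \<open>n\<close> of them, and all lists
  are used up. Hence every half-edge counts as processed and labels agree along edges.\<close>

lemma spanning_forestI:
  assumes "search_inv (R, A, l)" "\<not> R Start < R NodeCount"
  shows "spanning_forest n m L A \<and> R Back = n"
proof -
  interpret search_state n m L A "R Front" "R Back" "R Start" using assms(1) by simp
  have start: "R Start = n" using assms r_le by (auto simp: frame_def)
  then have front: "R Front = R Back" using finished by simp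
  have visited: "A Rank v \<noteq> 0" if "v < n" for v using before_start start that by simp
  have back_eq: "R Back = n"
  proof -
    have "{..<n} \<subseteq> A Queue ` {..<R Back}"
    proof
      fix v assume "v \<in> {..<n}"
      then show "v \<in> A Queue ` {..<R Back}"
        using visited[of v] rank[of v] by (intro image_eqI[of _ _ "A Rank v - 1"]) auto
    qed
    then have "card {..<n} \<le> card {..<R Back}" by (intro surj_card_le) auto
    with qt_le show ?thesis by simp
  qed
  have head: "A Head v = 0" if "v < n" for v
    using head_dequeued[of "A Rank v - 1"] rank[OF visited[OF that]] visited[OF that] front by auto
  have "spanning_forest n m L A"
  proof
    show "i < n \<Longrightarrow> A Queue i < n \<and> A Rank (A Queue i) = Suc i" for i using queue back_eq by simp
    show "v < n \<Longrightarrow> A Rank v \<noteq> 0 \<and> A Rank v \<le> n \<and> A Queue (A Rank v - 1) = v" for v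
      using visited rank back_eq by blast
    show "A Comp (L (2 + 2 * e)) = A Comp (L (3 + 2 * e))" if e: "e < m" for e
      using processed[of "2 * e + 1"] head end_less[OF e] e unfolding half_first by simp
    show "A ParEdge v < m \<and> {L (2 + 2 * A ParEdge v), L (3 + 2 * A ParEdge v)} = {v, A Parent v} \<and>
      A Parent v < n \<and> A Rank (A Parent v) < A Rank v \<and>
      A Comp (A Parent v) = A Comp v \<and> A InTree (A ParEdge v) \<noteq> 0"
      if "v < n" "A Comp v \<noteq> v" for v
      using tree[OF visited[OF that(1)] that(2)] rank by blast
    show "A InTree e \<noteq> 0 \<Longrightarrow> \<exists>v<n. A Comp v \<noteq> v \<and> A ParEdge v = e" for e
      using in_tree rank by blast
  qed
  with back_eq show ?thesis by simp
qed

text \<open>The equivalence also keeps the forest edges undirected, as the traversal requires at its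
  start.\<close>

fun extra_inv :: "conf \<Rightarrow> bool" where
  "extra_inv (R, A, l) \<longleftrightarrow> frame R \<and> l = L \<and> R Back = n \<and> R Edg \<le> m \<and> R Pos = 2 + 2 * R Edg \<and>
     spanning_forest n m L A \<and> spanning_forest.directed m L (A Sat) (A Dir) \<and>
     (\<forall>e<m. A Dir e \<noteq> 0 \<longleftrightarrow> e < R Edg \<and> A InTree e = 0)"

lemma extra_inv_start:
  assumes "search_inv (R, A, l)" "\<not> R Start < R NodeCount"
  shows "extra_inv (eff b reset_blk (R, A, l))"
proof -
  have F: "spanning_forest n m L A" "R Back = n" using spanning_forestI[OF assms] by auto
  then show ?thesis
    using assms(1) by (simp add: reset_blk_def frame_def spanning_forest.directed_def[OF F(1)])
qed

lemma spanning_forest_cong: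
  assumes "spanning_forest n m L A"
    and "A' Queue = A Queue" "A' Rank = A Rank" "A' Comp = A Comp" "A' ParEdge = A ParEdge"
      "A' Parent = A Parent" "A' InTree = A InTree"
  shows "spanning_forest n m L A'"
  using assms(1) unfolding spanning_forest_def spanning_forest_axioms_def assms(2-) .

lemma extra_step:
  assumes I: "extra_inv (R, A, l)" and lt: "R Edg < R EdgeCount"
  shows "extra_inv (eff (3 * m + 2) extra_body (R, A, l))"
proof -
  interpret spanning_forest n m L A using I by simp
  define e where "e = R Edg"
  have R: "R Edg = e" "e < m" "R Pos = 2 + 2 * e" "l = L" "R Zero = 0" "R One = 1"
    using I lt by (auto simp: e_def frame_def)
  have F: "spanning_forest n m L (A(Sat := s, Dir := d))" for s d
    by (rule spanning_forest_cong[OF spanning_forest_axioms]) simp_all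
  have D: "directed (A Sat) (A Dir)" and D0: "\<forall>e'<m. A Dir e' \<noteq> 0 \<longleftrightarrow> e' < e \<and> A InTree e' = 0"
    using I R by auto
  show ?thesis
  proof (cases "A InTree e = 0")
    case True
    have "directed ((A Sat)(L (2 + 2 * e) := 1)) ((A Dir)(e := Suc (L (2 + 2 * e))))"
      using directed_update[OF D R(2)] D0 R(2) by auto
    moreover have "\<forall>e'<m. ((A Dir)(e := Suc (L (2 + 2 * e)))) e' \<noteq> 0 \<longleftrightarrow> e' < Suc e \<and> A InTree e' = 0"
      using D0 True by (auto simp: less_Suc_eq)
    ultimately show ?thesis
      using I R True F by (simp add: extra_body_def frame_def)
  next
    case False
    have "\<forall>e'<m. A Dir e' \<noteq> 0 \<longleftrightarrow> e' < Suc e \<and> A InTree e' = 0"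
      using D0 False by (auto simp: less_Suc_eq)
    then show ?thesis
      using I R False by (simp add: extra_body_def frame_def)
  qed
qed

text \<open>\<open>Back\<close>, left by the search at the queue length \<open>n\<close>, now counts
  down as the index of \<open>settled\<close>.\<close>

fun tree_inv :: "conf \<Rightarrow> bool" where
  "tree_inv (R, A, l) \<longleftrightarrow> frame R \<and> l = L \<and> R Back \<le> n \<and> R Pos = 2 + 2 * m \<and>
     spanning_forest n m L A \<and> spanning_forest.settled n m L A (R Back) (A Sat) (A Dir)"

lemma tree_inv_start:
  assumes I: "extra_inv (R, A, l)" and "\<not> R Edg < R EdgeCount"
  shows "tree_inv (R, A, l)"
proof -
  interpret spanning_forest n m L A using I by simp
  have "R Edg = m" "R Back = n" using assms by (auto simp: frame_def)
  moreover have "A Dir (A ParEdge v) = 0" if "v < n" "A Comp v \<noteq> v" for v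
    using tree[OF that] I by auto
  ultimately have "settled n (A Sat) (A Dir)"
    using I rank unfolding settled_def by (auto simp: leD)
  then show ?thesis using I \<open>R Edg = m\<close> \<open>R Back = n\<close> spanning_forest_axioms by simp
qed

lemma tree_step:
  assumes I: "tree_inv (R, A, l)" and lt: "R Zero < R Back"
  shows "tree_inv (eff b tree_body (R, A, l)) \<and>
    fst (eff b tree_body (R, A, l)) Back < R Back"
proof -
  interpret spanning_forest n m L A using I by simp
  obtain i where i: "R Back = Suc i" using lt by (cases "R Back") auto
  have R: "i < n" "R Zero = 0" "R One = 1" "settled (Suc i) (A Sat) (A Dir)"
    using I i by (auto simp: frame_def)
  define v where "v = A Queue i"
  have F: "spanning_forest n m L (A(Sat := s, Dir := d))" for s d
    by (rule spanning_forest_cong[OF spanning_forest_axioms]) simp_all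
  \<comment> \<open>\<open>settled\<close> depends on the whole of \<open>A\<close> formally, but
    reads neither \<open>Sat\<close> nor \<open>Dir\<close> from it.\<close>
  have settled_cong: "spanning_forest.settled n m L (A(Sat := s, Dir := d)) = settled" for s d
    by (intro ext) (simp add: settled_def spanning_forest.settled_def[OF F] directed_def
        spanning_forest.directed_def[OF F])
  show ?thesis
  proof (cases "A Comp v = v")
    case True
    then have "settled i (A Sat) (A Dir)" using settled_root[OF R(4,1)] by (simp add: v_def)
    then show ?thesis
      using I R i True spanning_forest_axioms by (simp add: tree_body_def frame_def v_def)
  next
    case False
    define t where "t = (if A Sat v = 0 then v else A Parent v)"
    have "eff b tree_body (R, A, l) = eff b settle (R(Back := i, Src := v, Tmp := A Comp v), A, l)"
      using False i by (auto simp: tree_body_def v_def)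
    moreover have "\<exists>R'. eff b settle (R(Back := i, Src := v, Tmp := A Comp v), A, l) =
        (R', A(Sat := (A Sat)(t := 1), Dir := (A Dir)(A ParEdge v := Suc t)), l) \<and>
        frame R' \<and> R' Back = i \<and> R' Pos = R Pos"
      using I R by (auto simp: settle_def t_def frame_def)
    ultimately show ?thesis
      using settled_step[OF R(4,1) v_def False t_def] I R i F by (auto simp: settled_cong)
  qed
qed

fun output_inv :: "(nat \<Rightarrow> nat) \<Rightarrow> conf \<Rightarrow> bool" where
  "output_inv d (R, A, l) \<longleftrightarrow> R EdgeCount = m \<and> R Edg \<le> m \<and> R Pos = 2 + 2 * m + R Edg \<and> A Dir = d \<and>
     (\<forall>i<R Edg. l (2 + 2 * m + i) = d i - 1)"

text \<open>The cell \<open>2 + 2 * m + R Edg\<close> lies below \<open>3 * m + 2\<close>, so the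
  guard of \<open>Write\<close> lets the store through.\<close>

lemma output_step:
  assumes "output_inv d (R, A, l)" "R Edg < R EdgeCount"
  shows "output_inv d (eff (3 * m + 2) output_body (R, A, l))"
  using assms by (auto simp: output_body_def less_Suc_eq)

subsection \<open>The whole program\<close>

definition edge_pot :: "conf \<Rightarrow> nat" where
  "edge_pot s = m - fst s Edg"

lemma edg_eff:
  "fst (eff b build_body (R, A, l)) Edg = Suc (R Edg)"
  "fst (eff b extra_body (R, A, l)) Edg = Suc (R Edg)"
  "fst (eff b output_body (R, A, l)) Edg = Suc (R Edg)"
  by (auto simp: build_body_def link_def extra_body_def output_body_def)

text \<open>Unsatisfied nodes are their own labels; this yields \<open>single\<close> in
  \<open>max_orientationI\<close>.\<close>

definition certificate :: "(nat \<Rightarrow> nat) \<Rightarrow> (nat \<Rightarrow> nat) \<Rightarrow> bool" where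
  "certificate d cmp \<longleftrightarrow> (\<forall>e<m. d e \<in> {L (2 + 2 * e), L (3 + 2 * e)}) \<and>
     (\<forall>e<m. cmp (L (2 + 2 * e)) = cmp (L (3 + 2 * e))) \<and>
     (\<forall>v<n. (\<forall>e<m. d e \<noteq> v) \<longrightarrow> cmp v = v \<and> inj_on d {e \<in> {..<m}. cmp (d e) = v})"

lemma main_correct:
  "\<exists>j s' d cmp. runs (3 * m + 2) main j (\<lambda>_. 0, \<lambda>_ _. 0, L) s' \<and>
     j \<le> total_len * (3 * (n + m) + 1) \<and> (\<forall>e<m. snd (snd s') (2 + 2 * m + e) = d e) \<and>
     certificate d cmp"
proof -
  let ?b = "3 * m + 2"
  let ?s0 = "(\<lambda>_. 0, \<lambda>_ _. 0, L) :: conf"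
  let ?s1 = "eff ?b init_blk ?s0"
  have "build_inv ?s1"
    by (simp add: init_blk_def frame_def cells_def linked_def L0 L1)
  moreover have "edge_pot ?s1 \<le> m" by (simp add: edge_pot_def)
  moreover have "build_inv (eff ?b build_body (R, A, l)) \<and>
      edge_pot (eff ?b build_body (R, A, l)) < edge_pot (R, A, l)"
    if "build_inv (R, A, l)" "R Edg < R EdgeCount" for R A l
    using build_step[OF that] that by (simp add: edge_pot_def edg_eff frame_def diff_less_mono2)
  ultimately obtain s2 where s2: "runs ?b (loop Edg EdgeCount build_body)
      (Suc (len build_body) * m + 1) ?s1 s2" "build_inv s2" "\<not> fst s2 Edg < fst s2 EdgeCount"
    by (rule runs_loopE)
  have "search_inv s2" "search_pot s2 \<le> 2 * m + 3 * n"
    using search_inv_start[of "fst s2" "fst (snd s2)" "snd (snd s2)"] s2(2,3) by simp_all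
  then obtain s3 where s3: "runs ?b (loop Start NodeCount search_body)
      (Suc (len search_body) * (2 * m + 3 * n) + 1) s2 s3" "search_inv s3"
      "\<not> fst s3 Start < fst s3 NodeCount"
    by (rule runs_loopE) (rule search_step)
  let ?s4 = "eff ?b reset_blk s3"
  have "extra_inv ?s4"
    using extra_inv_start[of "fst s3" "fst (snd s3)" "snd (snd s3)"] s3(2,3) by simp
  moreover have "edge_pot ?s4 \<le> m" by (simp add: edge_pot_def)
  moreover have "extra_inv (eff ?b extra_body (R, A, l)) \<and>
      edge_pot (eff ?b extra_body (R, A, l)) < edge_pot (R, A, l)"
    if "extra_inv (R, A, l)" "R Edg < R EdgeCount" for R A l
    using extra_step[OF that] that by (simp add: edge_pot_def edg_eff frame_def diff_less_mono2)
  ultimately obtain s5 where s5: "runs ?b (loop Edg EdgeCount extra_body)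
      (Suc (len extra_body) * m + 1) ?s4 s5" "extra_inv s5" "\<not> fst s5 Edg < fst s5 EdgeCount"
    by (rule runs_loopE)
  have tree5: "tree_inv s5"
    using tree_inv_start[of "fst s5" "fst (snd s5)" "snd (snd s5)"] s5(2,3) by simp
  moreover have "fst s5 Back \<le> n" using tree5 by (cases s5) simp
  ultimately obtain s6 where s6: "runs ?b (loop Zero Back tree_body)
      (Suc (len tree_body) * n + 1) s5 s6" "tree_inv s6" "\<not> fst s6 Zero < fst s6 Back"
    by (rule runs_loopE[where f = "\<lambda>s. fst s Back"]) (use tree_step in simp)
  obtain R A l where s6_eq: "s6 = (R, A, l)" by (cases s6)
  let ?s7 = "eff ?b (Copy Edg Zero) s6"
  have "output_inv (A Dir) ?s7" using s6 by (simp add: s6_eq frame_def)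
  moreover have "edge_pot ?s7 \<le> m" by (simp add: edge_pot_def)
  moreover have "output_inv (A Dir) (eff ?b output_body (R', A', l')) \<and>
      edge_pot (eff ?b output_body (R', A', l')) < edge_pot (R', A', l')"
    if "output_inv (A Dir) (R', A', l')" "R' Edg < R' EdgeCount" for R' A' l'
    using output_step[OF that] that by (simp add: edge_pot_def edg_eff diff_less_mono2)
  ultimately obtain s8 where s8: "runs ?b (loop Edg EdgeCount output_body)
      (Suc (len output_body) * m + 1) ?s7 s8" "output_inv (A Dir) s8" "\<not> fst s8 Edg < fst s8 EdgeCount"
    by (rule runs_loopE)
  note run = runs_Seq[OF runs_compile runs_Seq[OF s2(1) runs_Seq[OF s3(1) runs_Seq[OF runs_compile
      runs_Seq[OF s5(1) runs_Seq[OF s6(1) runs_Seq[OF runs_compile s8(1)]]]]]], folded main_def]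
  interpret spanning_forest n m L A using s6(2) by (simp add: s6_eq)
  have settled: "settled 0 (A Sat) (A Dir)" using s6(2,3) by (simp add: s6_eq frame_def)
  have dir: "A Dir e = Suc (A Dir e - 1)" if "e < m" for e
    using settled_certificate(1)[OF settled that] by auto
  have "certificate (\<lambda>e. A Dir e - 1) (A Comp)"
    unfolding certificate_def
  proof (intro conjI allI impI)
    show "A Dir e - 1 \<in> {L (2 + 2 * e), L (3 + 2 * e)}" if "e < m" for e
      using settled_certificate(1)[OF settled that] by auto
    fix v assume v: "v < n" "\<forall>e<m. A Dir e - 1 \<noteq> v"
    then have "\<forall>e<m. A Dir e \<noteq> Suc v" by auto
    then show "A Comp v = v" "inj_on (\<lambda>e. A Dir e - 1) {e \<in> {..<m}. A Comp (A Dir e - 1) = v}"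
      using settled_certificate(2,3)[OF settled v(1)] by auto
  qed (rule comp_ends)
  moreover have "\<forall>e<m. snd (snd s8) (2 + 2 * m + e) = A Dir e - 1"
    using s8(2,3) by (cases s8) simp
  moreover have "len init_blk + (Suc (len build_body) * m + 1 + (Suc (len search_body) * (2 * m + 3 * n) + 1 +
      (len reset_blk + (Suc (len extra_body) * m + 1 + (Suc (len tree_body) * n + 1 +
      (len (Copy Edg Zero) + (Suc (len output_body) * m + 1)))))))
    \<le> total_len * (3 * (n + m) + 1)"
    unfolding total_len_def by (simp add: algebra_simps)
  ultimately show ?thesis
    using run by - (rule exI, rule exI, rule exI, rule exI, intro conjI; assumption)
qed

end

section \<open>Running time and word size on an encoded input\<close>

lemma exec_prelude:
  assumes xs: "length xs = 2 + 2 * m" "xs ! 1 = m" and W: "3 * m + 2 < W"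
  shows "\<exists>S. exec W prelude (init_state xs) 6 S \<and>
    represents (3 * m + 2) (\<lambda>_. 0, \<lambda>_ _. 0, \<lambda>i. if i < length xs then xs ! i else 0) S"
proof -
  define M where "M = (\<lambda>a. if a < length xs then xs ! a else 0)"
  define R where "R v = ((\<lambda>_. 0)(1 := 1, 2 := m, 0 := v) :: nat \<Rightarrow> nat)" for v
  have M1: "M 1 = m" using xs by (simp add: M_def)
  have add: "exec W (Add 0 0 2) (R v, M) 1 (R w, M)" if "w < W" "w = v + m" for v w
    using exec.Add[of "R v" 0 2 W 0 M] that by (simp add: R_def)
  have six: "(6 :: nat) = 1 + (1 + (1 + (1 + (1 + 1))))" by simp
  have "exec W prelude (init_state xs) 6 (R (3 * m + 2), M)"
    unfolding prelude_def six
  proof (intro exec.Seq)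
    show "exec W (Const 1 1) (init_state xs) 1 ((\<lambda>_. 0)(1 := 1), M)"
      unfolding init_state_def M_def using W by (intro exec.Const) simp
    show "exec W (Load 2 1) ((\<lambda>_. 0)(1 := 1), M) 1 ((\<lambda>_. 0)(1 := 1, 2 := m), M)"
      using exec.Load[of W 2 1 "(\<lambda>_. 0)(1 := 1)" M] M1 by simp
    show "exec W (Const 0 2) ((\<lambda>_. 0)(1 := 1, 2 := m), M) 1 (R 2, M)"
      unfolding R_def using W by (intro exec.Const) simp
    show "exec W (Add 0 0 2) (R 2, M) 1 (R (m + 2), M)"
      "exec W (Add 0 0 2) (R (m + 2), M) 1 (R (2 * m + 2), M)"
      "exec W (Add 0 0 2) (R (2 * m + 2), M) 1 (R (3 * m + 2), M)"
      using W by (intro add; simp)+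
  qed
  moreover have "represents (3 * m + 2) (\<lambda>_. 0, \<lambda>_ _. 0, M) (R (3 * m + 2), M)"
    using xs by (simp add: R_def M_def)
  ultimately show ?thesis unfolding M_def by blast
qed

text \<open>Ten steps for each unit of \<open>total_len * (3 * N + 1)\<close>; the remaining 10
  covers the six steps of \<open>prelude\<close>.\<close>

definition time_factor :: nat where
  "time_factor = 10 * (3 * total_len + 1)"

definition word_exponent :: nat where
  "word_exponent = Suc (16 * (3 * total_len + 3))"

text \<open>A bound \<open>?a * (N + 2)\<close> is enough, and \<open>?a < 2 ^ ?a\<close>. As the
  base \<open>N + 2\<close> is at least 2, the constant factor moves into the exponent.\<close>

lemma word_bound:
  assumes "j \<le> total_len * (3 * N + 1)" "m \<le> N"
  shows "3 * m + 2 + 16 * (N + j) + 16 < (N + 2) ^ word_exponent"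
proof -
  let ?a = "16 * (3 * total_len + 3)"
  have "3 * m + 2 + 16 * (N + j) + 16 \<le> ?a * (N + 2)"
    using assms by (simp add: algebra_simps)
  also have "\<dots> < 2 ^ ?a * (N + 2)"
    by (rule mult_strict_right_mono[OF less_exp]) simp
  also have "\<dots> \<le> (N + 2) ^ ?a * (N + 2)"
    by (intro mult_le_mono1 power_mono) simp_all
  also have "\<dots> = (N + 2) ^ word_exponent"
    unfolding word_exponent_def by (simp only: power_Suc mult.commute)
  finally show ?thesis .
qed

lemma main_outputs:
  assumes "edge_list n m (\<lambda>i. if i < length xs then xs ! i else 0)"
    and xs: "length xs = 2 + 2 * m" "\<forall>x \<in> set xs. x \<le> n + m"
  shows "\<exists>t d cmp. outputs_in ((n + m + 2) ^ word_exponent) (Seq prelude main) xs t (map d [0..<m]) \<and>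
    t \<le> time_factor * (n + m + 1) \<and>
    edge_list.certificate n m (\<lambda>i. if i < length xs then xs ! i else 0) d cmp"
proof -
  define L where "L = (\<lambda>i. if i < length xs then xs ! i else 0)"
  interpret edge_list n m L using assms(1) by (simp add: L_def)
  let ?s = "(\<lambda>_. 0, \<lambda>_ _. 0, L) :: conf"
  let ?W = "(n + m + 2) ^ word_exponent"
  obtain j s' d cmp where j: "runs (3 * m + 2) main j ?s s'" "j \<le> total_len * (3 * (n + m) + 1)"
      and d: "\<forall>e<m. snd (snd s') (2 + 2 * m + e) = d e" "certificate d cmp"
    using main_correct by blast
  have W: "3 * m + 2 + 16 * (n + m + j) + 16 < ?W"
    using word_bound[OF j(2), of m] by simp
  have "xs ! 1 = m" using L1 xs(1) by (simp add: L_def)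
  moreover have "3 * m + 2 < ?W" using W by simp
  ultimately obtain S where S: "exec ?W prelude (init_state xs) 6 S" "represents (3 * m + 2) ?s S"
    using exec_prelude[OF xs(1)] unfolding L_def by blast
  have "bounded_by (n + m) ?s" using xs(2) by (simp add: L_def)
  then obtain t S' where t: "exec ?W main S t S'" "t \<le> 10 * j" "represents (3 * m + 2) s' S'"
    using runsE[OF j(1) S(2) _ W] by blast
  obtain R M where eq: "S' = (R, M)" by (cases S')
  have "M (length xs + i) = map d [0..<m] ! i" if "i < m" for i
  proof -
    have "M (2 + 2 * m + i) = snd (snd s') (2 + 2 * m + i)"
      using t(3) that eq by (cases s') simp
    then show ?thesis using d(1) that xs(1) by simp
  qed
  then have "outputs_in ?W (Seq prelude main) xs (6 + t) (map d [0..<m])"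
    using exec.Seq[OF S(1) t(1)] eq unfolding outputs_in_def by auto
  moreover have "6 + t \<le> time_factor * (n + m + 1)"
    using t(2) j(2) by (simp add: time_factor_def algebra_simps)
  ultimately show ?thesis using d(2) unfolding L_def by blast
qed

section \<open>Transfer to abstract multigraphs\<close>

lemma max_orientation_certificate:
  assumes G: "finite_loopless_multigraph G" and xs: "encodes_graph G ps es xs"
    and L: "L = (\<lambda>i. if i < length xs then xs ! i else 0)"
    and E: "edge_list n m L" "n = length ps" "m = length es"
    and cert: "edge_list.certificate n m L d cmp"
  shows "\<exists>h. encodes_orientation ps es h (map d [0..<m]) \<and> max_orientation G h"
proof -
  interpret edge_list n m L by (rule E)
  have ps: "distinct ps" "set ps = nodes G" and es: "distinct es" "set es = edges G"
    and len: "length xs = 2 + 2 * m"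
    and ends: "\<And>e. e < m \<Longrightarrow> ends G (es ! e) = {ps ! L (2 + 2 * e), ps ! L (3 + 2 * e)}"
    using xs by (auto simp: encodes_graph_def E L)
  define node where "node = the_inv_into {..<n} ((!) ps)"
  define edge where "edge = the_inv_into {..<m} ((!) es)"
  have node: "node (ps ! i) = i" if "i < n" for i
    unfolding node_def using ps that E by (intro the_inv_into_f_f) (auto simp: inj_on_nth)
  have edge: "edge (es ! e) = e" if "e < m" for e
    unfolding edge_def using es that E by (intro the_inv_into_f_f) (auto simp: inj_on_nth)
  define h where "h x = ps ! d (edge x)" for x
  have h: "h (es ! e) = ps ! d e" if "e < m" for e using edge[OF that] by (simp add: h_def)
  have edges: "\<exists>e<m. x = es ! e" if "x \<in> edges G" for x
    using that es E by (metis in_set_conv_nth)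
  have nodes: "\<exists>v<n. p = ps ! v" if "p \<in> nodes G" for p
    using that ps E by (metis in_set_conv_nth)
  have d: "d e \<in> {L (2 + 2 * e), L (3 + 2 * e)}" "d e < n"
    and cmp: "cmp (L (2 + 2 * e)) = cmp (L (3 + 2 * e))" if "e < m" for e
    using cert end_less[OF that] that unfolding certificate_def by auto
  have unsat: "\<forall>e<m. d e \<noteq> v" if "v < n" "\<not> satisfied G h (ps ! v)" for v
  proof (intro allI impI notI)
    fix e assume e: "e < m" "d e = v"
    then have "es ! e \<in> edges G" "ps ! v \<in> ends G (es ! e)" "h (es ! e) = ps ! v"
      using es E d(1)[OF e(1)] ends[OF e(1)] h by auto
    then show False using that(2) unfolding satisfied_def by blast
  qed
  have "encodes_orientation ps es h (map d [0..<m])"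
    using d(2) h E by (simp add: encodes_orientation_def)
  moreover have "max_orientation G h"
  proof (rule max_orientationI[OF G, where comp = "\<lambda>p. cmp (node p)"])
    show "orientation G h"
      unfolding orientation_def using edges d(1) h ends by fastforce
    show "cmp (node u) = cmp (node v)" if "x \<in> edges G" "u \<in> ends G x" "v \<in> ends G x" for x u v
      using edges[OF that(1)] that(2,3) ends node end_less cmp by auto
    show "p = q" if pq: "p \<in> nodes G" "q \<in> nodes G" "\<not> satisfied G h p" "\<not> satisfied G h q"
      "cmp (node p) = cmp (node q)" for p q
    proof -
      obtain v w where "v < n" "p = ps ! v" "w < n" "q = ps ! w"
        using nodes pq(1,2) by blast
      then show ?thesis
        using pq(3-5) unsat cert node unfolding certificate_def by metis
    qed
    show "inj_on h {x \<in> edges G. cmp (node (h x)) = cmp (node p)}"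
      if p: "p \<in> nodes G" "\<not> satisfied G h p" for p
    proof -
      obtain v where v: "v < n" "p = ps ! v" using nodes p(1) by blast
      then have c: "cmp v = v" "inj_on d {e \<in> {..<m}. cmp (d e) = v}"
        using cert unsat p(2) unfolding certificate_def by blast+
      show ?thesis
      proof (rule inj_onI)
        fix x y
        assume x: "x \<in> {x \<in> edges G. cmp (node (h x)) = cmp (node p)}"
          and y: "y \<in> {x \<in> edges G. cmp (node (h x)) = cmp (node p)}" and eq: "h x = h y"
        obtain e e' where e: "e < m" "x = es ! e" "e' < m" "y = es ! e'"
          using edges x y by blast
        then have "d e = d e'" using eq h d(2) node by metis
        moreover have "cmp (d e) = v" "cmp (d e') = v"
          using x y e v c h d(2) node by auto
        ultimately show "x = y" using e c(2) by (auto dest: inj_onD)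
      qed
    qed
  qed
  ultimately show ?thesis by blast
qed

text \<open>Equal end numbers would make \<open>ends\<close> a singleton, against looplessness. The
  second claim supplies the initial value bound for \<open>runs\<close>.\<close>

lemma edge_list_encoding:
  assumes G: "finite_loopless_multigraph G" and xs: "encodes_graph G ps es xs"
  shows "edge_list (length ps) (length es) (\<lambda>i. if i < length xs then xs ! i else 0)"
    and "\<forall>x \<in> set xs. x \<le> length ps + length es"
proof -
  let ?n = "length ps" and ?m = "length es"
  have len: "length xs = 2 + 2 * ?m" "xs ! 0 = ?n" "xs ! 1 = ?m"
    and less: "\<And>e. e < ?m \<Longrightarrow> xs ! (2 + 2 * e) < ?n \<and> xs ! (3 + 2 * e) < ?n"
    and ends: "\<And>e. e < ?m \<Longrightarrow> ends G (es ! e) = {ps ! (xs ! (2 + 2 * e)), ps ! (xs ! (3 + 2 * e))}"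
    using xs by (auto simp: encodes_graph_def)
  have neq: "xs ! (2 + 2 * e) \<noteq> xs ! (3 + 2 * e)" if "e < ?m" for e
  proof
    assume "xs ! (2 + 2 * e) = xs ! (3 + 2 * e)"
    then have "card (ends G (es ! e)) = 1" using ends[OF that] by simp
    moreover have "es ! e \<in> edges G" using xs that by (auto simp: encodes_graph_def)
    then have "card (ends G (es ! e)) = 2" using G by (simp add: finite_loopless_multigraph_def)
    ultimately show False by simp
  qed
  show "edge_list ?n ?m (\<lambda>i. if i < length xs then xs ! i else 0)"
    by unfold_locales (use len less neq in auto)
  show "\<forall>x \<in> set xs. x \<le> ?n + ?m"
  proof
    fix x assume "x \<in> set xs"
    then obtain i where i: "i < 2 + 2 * ?m" "x = xs ! i" using len by (metis in_set_conv_nth)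
    consider "i = 0" | "i = 1" | e where "i = 2 + 2 * e" "e < ?m" | e where "i = 3 + 2 * e" "e < ?m"
    proof -
      have "i = 0 \<or> i = 1 \<or> (i = 2 + 2 * ((i - 2) div 2) \<or> i = 3 + 2 * ((i - 2) div 2)) \<and> (i - 2) div 2 < ?m"
        using i(1) by presburger
      then show thesis using that by blast
    qed
    then show "x \<le> ?n + ?m"
    proof cases
      case 3
      then show ?thesis using less[of e] i by simp
    next
      case 4
      then show ?thesis using less[of e] i by simp
    qed (use i len in simp_all)
  qed
qed

theorem theorem5:
  shows "\<exists>(c :: com) (T :: nat \<Rightarrow> nat) (k :: nat).
    (\<lambda>N. real (T N)) \<in> O(\<lambda>N. real N) \<and>
    (\<forall>(G :: ('p, 'e) multigraph) ps es xs.
       finite_loopless_multigraph G \<longrightarrow> encodes_graph G ps es xs \<longrightarrow>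
       (let N = card (nodes G) + card (edges G) in
        \<exists>t ys h. outputs_in ((N + 2) ^ k) c xs t ys \<and> t \<le> T N \<and>
                 encodes_orientation ps es h ys \<and> max_orientation G h))"
proof (intro exI conjI allI impI)
  show "(\<lambda>N. real (time_factor * (N + 1))) \<in> O(\<lambda>N. real N)"
    \<comment> \<open>From \<open>N = 1\<close> on, \<open>N + 1 \<le> 2 * N\<close>; hence the
      doubled factor.\<close>
    by (intro bigoI[where c = "real (2 * time_factor)"] eventually_sequentiallyI[of 1])
      (simp flip: of_nat_mult of_nat_add add: algebra_simps)
  fix G :: "('p, 'e) multigraph" and ps es xs
  assume G: "finite_loopless_multigraph G" and xs: "encodes_graph G ps es xs"
  let ?n = "length ps" and ?m = "length es" and ?L = "\<lambda>i. if i < length xs then xs ! i else 0"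
  have N: "card (nodes G) = ?n" "card (edges G) = ?m" and len: "length xs = 2 + 2 * ?m"
    using xs by (auto simp: encodes_graph_def simp flip: distinct_card)
  note E = edge_list_encoding[OF G xs]
  obtain t d cmp where "outputs_in ((?n + ?m + 2) ^ word_exponent) (Seq prelude main) xs t (map d [0..<?m])"
      "t \<le> time_factor * (?n + ?m + 1)" and cert: "edge_list.certificate ?n ?m ?L d cmp"
    using main_outputs[OF E(1) len E(2)] by blast
  moreover obtain h where "encodes_orientation ps es h (map d [0..<?m])" "max_orientation G h"
    using max_orientation_certificate[OF G xs refl E(1) refl refl cert] by blast
  ultimately show "let N = card (nodes G) + card (edges G) in
      \<exists>t ys h. outputs_in ((N + 2) ^ word_exponent) (Seq prelude main) xs t ys \<and>
        t \<le> time_factor * (N + 1) \<and> encodes_orientation ps es h ys \<and> max_orientation G h"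
    unfolding Let_def N by blast
qed

end
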